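(* Let $q$ be even and $k\ge 2$. Then an ${\rm Sp}(4k-2,q)$-space has a maximal symplectic partial spread of size $q^k+1$.
   Context: An ${\rm Sp}(2n,q)$-space is a $2n$-dimensional $\mathbb{F}_q$-space with a nondegenerate alternating form. A symplectic partial spread is a set of totally isotropic $n$-dimensional subspaces pairwise meeting only in $0$; it is maximal if not properly contained in another symplectic partial spread. *)

theory Defs
  imports "HOL.Vector_Spaces" "HOL-Library.Cardinality"
begin

(* The clause "\<exists>A. finite A \<and> span A = UNIV" is needed because dim is 0 on
   spaces without a finite basis. *)
locale Sp_space = vector_space scale
  for scale :: "'f::{field,finite} \<Rightarrow> 'v::ab_group_add \<Rightarrow> 'v" (infixr "*s" 75) +
  fixes form :: "'v \<Rightarrow> 'v \<Rightarrow> 'f" and n q :: nat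
  assumes card_field: "CARD('f) = q"
    and finite_dim: "\<exists>A. finite A \<and> span A = UNIV"
    and dim_space: "dim (UNIV :: 'v set) = 2 * n"
    and form_linear_left: "\<And>w. Vector_Spaces.linear scale (*) (\<lambda>v. form v w)"
    and form_linear_right: "\<And>v. Vector_Spaces.linear scale (*) (\<lambda>w. form v w)"
    and form_alternating: "\<And>v. form v v = 0"
    and form_nondegenerate: "\<And>v. (\<forall>w. form v w = 0) \<Longrightarrow> v = 0"
begin

definition totally_isotropic :: "'v set \<Rightarrow> bool" where
  "totally_isotropic U \<longleftrightarrow> subspace U \<and> (\<forall>u\<in>U. \<forall>w\<in>U. form u w = 0)"

definition symplectic_partial_spread :: "'v set set \<Rightarrow> bool" where
  "symplectic_partial_spread S \<longleftrightarrow>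
     (\<forall>U\<in>S. totally_isotropic U \<and> dim U = n) \<and> pairwise (\<lambda>U W. U \<inter> W = {0}) S"

definition maximal_symplectic_partial_spread :: "'v set set \<Rightarrow> bool" where
  "maximal_symplectic_partial_spread S \<longleftrightarrow>
     symplectic_partial_spread S \<and> \<not> (\<exists>T. symplectic_partial_spread T \<and> S \<subset> T)"

end

end

theory Submission
  imports Defs "HOL-Algebra.Algebraic_Closure_Type" "HOL-Library.FuncSet" "HOL-Library.Product_Plus"
begin

text \<open>
  Let \<open>K = GF(q)\<close>, \<open>F = GF(q^k)\<close> and let \<open>T\<close> be a \<open>K\<close>-linear functional on \<open>F\<close> with \<open>T 1 = 1\<close>. On the
  \<open>2 \<times> 2\<close> matrices over \<open>F\<close>, \<open>T \<circ> det\<close> is a \<open>K\<close>-quadratic form of type \<open>O\<^sup>+(4k, q)\<close>, and the identity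
  matrix \<open>z\<close> is nonsingular. Since \<open>q\<close> is even, \<open>z\<^sup>\<bottom> / z\<close> is an \<open>Sp(4k - 2, q)\<close>-space. One ruling of the
  quadric \<open>det = 0\<close> consists of the \<open>q^k + 1\<close> spaces of matrices that kill a given point of the projective
  line over \<open>F\<close>; their intersections with \<open>z\<^sup>\<bottom>\<close> project to a symplectic partial spread.

  It is maximal: a totally isotropic subspace of dimension \<open>2k - 1\<close> lifts uniquely to a subspace of
  \<open>z\<^sup>\<bottom>\<close> on which \<open>T \<circ> det\<close> vanishes. There \<open>det\<close> takes values in the kernel of \<open>T\<close>, so it amounts to
  \<open>k - 1\<close> quadratic forms in \<open>2k - 1 > 2(k - 1)\<close> variables, which have a common nontrivial zero by the
  Chevalley-Warning argument. A zero of \<open>det\<close> lies on a member of the ruling.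
\<close>

section \<open>Finite fields and their extensions inside the algebraic closure\<close>

text \<open>Multiplication by a nonzero \<open>x\<close> permutes the nonzero elements; comparing
  the two products gives \<open>x ^ (CARD('f) - 1) = 1\<close>.\<close>

lemma power_CARD_eq_same:
  fixes x :: "'f::{field,finite}"
  shows "x ^ CARD('f) = x"
proof (cases "x = 0")
  case False
  have "(\<Prod>y\<in>UNIV-{0}. x * y) = (\<Prod>y\<in>UNIV-{0}. y)"
    by (rule prod.reindex_bij_witness[of _ "\<lambda>y. y / x" "\<lambda>y. x * y"]) (use False in auto)
  then have "x ^ (CARD('f) - 1) * \<Prod>(UNIV-{0}) = 1 * \<Prod>(UNIV-{0::'f})"
    by (simp add: prod.distrib card_Diff_singleton)
  then have "x ^ (CARD('f) - 1) = 1"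
    by (subst (asm) mult_right_cancel) auto
  then show ?thesis
    using power_minus_mult[of "CARD('f)" x] zero_less_card_finite by (metis mult_1)
qed simp

lemma CARD_field_gt_1: "CARD('f::{field,finite}) > 1"
proof -
  have "card {0, 1::'f} \<le> CARD('f)"
    by (rule card_mono) auto
  then show ?thesis by simp
qed

lemma of_nat_CARD_eq_0: "of_nat (CARD('f)) = (0::'f::{field,finite})"
proof -
  have "(\<Sum>x\<in>UNIV. x + 1) = (\<Sum>x\<in>UNIV. x::'f)"
    by (rule sum.reindex_bij_witness[of _ "\<lambda>x. x - 1" "\<lambda>x. x + 1"]) auto
  then show ?thesis by (simp add: sum.distrib)
qed

lemma two_eq_0_if_even_CARD:
  assumes "even (CARD('f::{field,finite}))"
  shows "(1::'f) + 1 = 0"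
proof -
  have "(-1::'f) = (-1) ^ CARD('f)" by (simp only: power_CARD_eq_same)
  then have "(-1::'f) = 1" using assms by simp
  then show ?thesis by (metis add.right_inverse)
qed

text \<open>Some nonzero \<open>u\<close> has \<open>u ^ e \<noteq> 1\<close>, because
  \<open>x ^ e - 1\<close> has at most \<open>e\<close> roots. Replacing \<open>t\<close> by
  \<open>u * t\<close> multiplies the sum by \<open>u ^ e\<close> yet leaves it unchanged.\<close>

lemma sum_powers_eq_0:
  assumes "e < CARD('f) - 1"
  shows "(\<Sum>t\<in>UNIV. t ^ e) = (0::'f::{field,finite})"
proof (cases "e = 0")
  \<comment> \<open>With \<open>0 ^ 0 = 1\<close>, the sum consists of \<open>CARD('f)\<close>
    ones.\<close>
  case True
  then show ?thesis using of_nat_CARD_eq_0[where 'f='f] by simp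
next
  case False
  obtain u :: 'f where u: "u \<noteq> 0" "u ^ e \<noteq> 1"
  proof (rule ccontr)
    assume "\<not> thesis"
    with that have *: "UNIV - {0} \<subseteq> {x::'f. x ^ e = 1}" by auto
    have "card (UNIV - {0::'f}) \<le> card {x::'f. x ^ e = 1}"
      by (rule card_mono) (use * in auto)
    also have "\<dots> \<le> e"
    proof -
      let ?p = "monom (1::'f) e - 1"
      have "coeff ?p e \<noteq> 0" using False by simp
      then have "?p \<noteq> 0" by (metis coeff_0)
      from card_poly_roots_bound[OF this] have "card {x::'f. x ^ e = 1} \<le> degree ?p"
        by (simp add: poly_monom)
      also have "\<dots> \<le> e" by (intro degree_diff_le degree_monom_le) simp
      finally show ?thesis .
    qed
    finally show False using assms by (simp add: card_Diff_singleton)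
  qed
  have "(\<Sum>t\<in>UNIV. (u * t) ^ e) = (\<Sum>t\<in>UNIV. t ^ e)"
    by (rule sum.reindex_bij_witness[of _ "\<lambda>y. y / u" "\<lambda>y. u * y"]) (use u in auto)
  then have "u ^ e * (\<Sum>t\<in>UNIV. t ^ e) = (\<Sum>t\<in>UNIV. t ^ e)"
    by (simp add: power_mult_distrib sum_distrib_left)
  with u show ?thesis by simp
qed

lemma of_nat_choose_CARD_eq_0:
  assumes "0 < i" "i < CARD('f)"
  shows "of_nat (CARD('f) choose i) = (0::'f::{field,finite})"
proof -
  let ?q = "CARD('f)"
  \<comment> \<open>\<open>(x + 1)^q - x^q - 1\<close> has degree less than \<open>q\<close> and vanishes on the whole field\<close>
  let ?p = "\<Sum>i\<in>{1..<?q}. monom (of_nat (?q choose i) :: 'f) i"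
  have deg: "degree ?p < ?q"
    by (rule degree_sum_less) (auto intro: le_less_trans[OF degree_monom_le] simp: CARD_field_gt_1)
  have "poly ?p x = 0" for x
  proof -
    have "x + 1 = (x + 1) ^ ?q" by (simp add: power_CARD_eq_same)
    also have "\<dots> = (\<Sum>i\<le>?q. of_nat (?q choose i) * x ^ i)"
      by (simp add: binomial_ring)
    also have "{..?q} = insert 0 (insert ?q {1..<?q})" by auto
    also have "(\<Sum>i\<in>\<dots>. of_nat (?q choose i) * x ^ i) = 1 + (x + poly ?p x)"
      by (subst sum.insert; simp add: power_CARD_eq_same poly_sum poly_monom)
    finally show ?thesis by (simp add: algebra_simps)
  qed
  then have "?p = 0"
    by (intro poly_eqI_degree[of UNIV]) (use deg in auto)
  then have "coeff ?p i = 0" by simp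
  then show ?thesis using assms by (simp add: coeff_sum coeff_monom)
qed


text \<open>The polynomial splits, and a repeated linear factor would give a common root with the
  derivative.\<close>

lemma card_roots_if_simple:
  fixes p :: "'a::alg_closed_field poly"
  assumes "p \<noteq> 0" and simple: "\<And>x. poly p x = 0 \<Longrightarrow> poly (pderiv p) x \<noteq> 0"
  shows "card {x. poly p x = 0} = degree p"
proof -
  obtain A where A: "size A = degree p" "p = smult (lead_coeff p) (\<Prod>x\<in>#A. [:-x, 1:])"
    using alg_closed_imp_factorization[OF \<open>p \<noteq> 0\<close>] by blast
  have roots: "{x. poly p x = 0} = set_mset A"
  proof -
    have "poly p x = lead_coeff p * (\<Prod>y\<in>#A. x - y)" for x
      by (subst A(2)) (simp add: poly_prod_mset image_mset.compositionality comp_def)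
    then show ?thesis using \<open>p \<noteq> 0\<close> by auto
  qed
  have "count A a = 1" if "a \<in># A" for a
  proof (rule ccontr)
    assume "count A a \<noteq> 1"
    with that obtain B where B: "A = add_mset a (add_mset a B)"
      by (metis count_add_mset count_greater_zero_iff insert_DiffM less_one linorder_neqE_nat
          multi_member_split not_in_iff One_nat_def)
    define r where "r = smult (lead_coeff p) (\<Prod>x\<in>#B. [:-x, 1:])"
    have "p = [:-a, 1:] * ([:-a, 1:] * r)" by (subst A(2)) (simp add: B r_def)
    then have "poly p a = 0" "poly (pderiv p) a = 0"
      by (simp_all only: poly_mult pderiv_mult poly_add) simp_all
    with simple show False by blast
  qed
  then have "size A = card (set_mset A)" by (simp add: size_multiset_overloaded_eq)
  with A(1) roots show ?thesis by simp
qed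

text \<open>The mixed binomial terms vanish by \<open>of_nat_choose_CARD_eq_0\<close>, transported
  by \<open>to_ac\<close>. This makes Frobenius additive without writing \<open>CARD('f)\<close> as
  a prime power.\<close>

lemma add_power_CARD_power:
  fixes x y :: "'f::{field,finite} alg_closure"
  shows "(x + y) ^ (CARD('f) ^ i) = x ^ (CARD('f) ^ i) + y ^ (CARD('f) ^ i)"
proof (induction i arbitrary: x y)
  case (Suc i)
  let ?q = "CARD('f)"
  have one: "(x + y) ^ ?q = x ^ ?q + y ^ ?q" for x y :: "'f alg_closure"
  proof -
    have *: "of_nat (?q choose j) = (0 :: 'f alg_closure)" if "0 < j" "j < ?q" for j
      using of_nat_choose_CARD_eq_0[OF that] to_ac_of_nat by (metis to_ac_0)
    have "(x + y) ^ ?q = (\<Sum>j\<le>?q. of_nat (?q choose j) * x ^ j * y ^ (?q - j))"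
      by (simp add: binomial_ring)
    also have "\<dots> = (\<Sum>j\<in>{0, ?q}. of_nat (?q choose j) * x ^ j * y ^ (?q - j))"
      by (rule sum.mono_neutral_right) (auto simp: *)
    also have "\<dots> = x ^ ?q + y ^ ?q" by simp
    finally show ?thesis .
  qed
  show ?case by (simp add: power_mult one Suc.IH)
qed simp

lemma sum_power_CARD_power:
  fixes f :: "'a \<Rightarrow> 'f::{field,finite} alg_closure"
  shows "(\<Sum>j\<in>A. f j) ^ (CARD('f) ^ i) = (\<Sum>j\<in>A. f j ^ (CARD('f) ^ i))"
  by (induction A rule: infinite_finite_induct) (simp_all add: add_power_CARD_power zero_power)

lemma to_ac_power_CARD_power [simp]:
  "to_ac (c::'f::{field,finite}) ^ (CARD('f) ^ i) = to_ac c"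
  by (induction i)
    (simp_all add: power_mult to_ac_power[symmetric] power_CARD_eq_same del: to_ac_power)

text \<open>The image of \<open>to_ac\<close> already supplies \<open>CARD('f)\<close> roots of
  \<open>x ^ CARD('f) - x\<close>, as many as the degree allows.\<close>

lemma range_to_ac: "range to_ac = {x. x ^ CARD('f) = (x :: 'f::{field,finite} alg_closure)}"
proof (rule card_subset_eq)
  let ?q = "CARD('f)"
  let ?p = "monom 1 ?q - monom (1 :: 'f alg_closure) 1"
  have "coeff ?p ?q \<noteq> 0" using CARD_field_gt_1[where 'f='f] by simp
  then have nz: "?p \<noteq> 0" by (metis coeff_0)
  have roots: "{x. x ^ ?q = (x :: 'f alg_closure)} = {x. poly ?p x = 0}"
    by (simp add: poly_monom)
  show fin: "finite {x. x ^ ?q = (x :: 'f alg_closure)}"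
    unfolding roots by (rule poly_roots_finite[OF nz])
  show sub: "range to_ac \<subseteq> {x. x ^ ?q = (x :: 'f alg_closure)}"
    using to_ac_power_CARD_power[where i=1] by auto
  have "degree ?p \<le> ?q"
    by (intro degree_diff_le order.trans[OF degree_monom_le]) (use CARD_field_gt_1[where 'f='f] in auto)
  then have "card {x. x ^ ?q = (x :: 'f alg_closure)} \<le> ?q"
    unfolding roots using card_poly_roots_bound[OF nz] by linarith
  moreover have "card (range to_ac :: 'f alg_closure set) = ?q"
    using card_image[OF inj_to_ac] by simp
  ultimately show "card (range to_ac :: 'f alg_closure set) = card {x. x ^ ?q = (x :: 'f alg_closure)}"
    using card_mono[OF fin sub] by simp
qed

text \<open>The field of order \<open>CARD('f) ^ k\<close> for \<open>k > 0\<close>, kept as a set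
  inside the closure because \<open>k\<close> is a variable. For \<open>k = 0\<close> it would be
  the whole closure.\<close>

definition GF_ext :: "nat \<Rightarrow> 'f::{field,finite} alg_closure set" where
  "GF_ext k = {x. x ^ (CARD('f) ^ k) = x}"

text \<open>The defining polynomial has derivative -1, so all its roots are simple.\<close>

lemma card_GF_ext:
  assumes "k > 0"
  shows "card (GF_ext k :: 'f::{field,finite} alg_closure set) = CARD('f) ^ k"
proof -
  let ?Q = "CARD('f) ^ k"
  let ?p = "monom 1 ?Q - monom (1 :: 'f alg_closure) 1"
  have gt: "?Q > 1" using assms CARD_field_gt_1[where 'f='f] one_less_power by blast
  then have "coeff ?p ?Q \<noteq> 0" by simp
  then have nz: "?p \<noteq> 0" by (metis coeff_0)
  have "of_nat ?Q = (0 :: 'f alg_closure)"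
    using to_ac_of_nat[of "?Q", where 'a='f] assms by (simp add: of_nat_CARD_eq_0 zero_power)
  then have "pderiv ?p = -1" 
    by (simp add: pderiv_diff pderiv_monom)
  then have "card {x. poly ?p x = 0} = degree ?p"
    by (intro card_roots_if_simple[OF nz]) simp
  moreover have "degree ?p = ?Q"
  proof (rule antisym)
    show "degree ?p \<le> ?Q"
      by (intro degree_diff_le order.trans[OF degree_monom_le]) (use gt in auto)
    show "?Q \<le> degree ?p" by (rule le_degree) (use gt in simp)
  qed
  ultimately show ?thesis by (simp add: GF_ext_def poly_monom)
qed

lemma GF_ext_closed:
  fixes x y :: "'f::{field,finite} alg_closure"
  shows "0 \<in> (GF_ext k :: 'f alg_closure set)" "1 \<in> (GF_ext k :: 'f alg_closure set)"
    "to_ac c \<in> (GF_ext k :: 'f alg_closure set)"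
    "x \<in> GF_ext k \<Longrightarrow> y \<in> GF_ext k \<Longrightarrow> x + y \<in> GF_ext k"
    "x \<in> GF_ext k \<Longrightarrow> y \<in> GF_ext k \<Longrightarrow> x * y \<in> GF_ext k"
    "x \<in> GF_ext k \<Longrightarrow> y \<in> GF_ext k \<Longrightarrow> x / y \<in> GF_ext k"
  by (simp_all add: GF_ext_def power_mult_distrib power_divide add_power_CARD_power)

lemma finite_GF_ext: "k > 0 \<Longrightarrow> finite (GF_ext k :: 'f::{field,finite} alg_closure set)"
  by (rule card_ge_0_finite) (simp add: card_GF_ext)

section \<open>The trace and the linear functional built from it\<close>

interpretation ac: vector_space "\<lambda>c x. to_ac (c::'f::field) * x"
  by unfold_locales (simp_all add: algebra_simps)

interpretation ac_ac: vector_space_pair "\<lambda>c x. to_ac (c::'f::field) * x" "\<lambda>c x. to_ac (c::'f::field) * x"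
  ..

interpretation ac_scalar: vector_space_pair "\<lambda>c x. to_ac (c::'f::field) * x" "(*) :: 'f \<Rightarrow> _"
  by unfold_locales (simp_all add: algebra_simps)

text \<open>On \<open>GF_ext k\<close> this is the relative trace to the base field, with values
  still in the closure.\<close>

definition GF_trace :: "nat \<Rightarrow> 'f::{field,finite} alg_closure \<Rightarrow> 'f alg_closure" where
  "GF_trace k x = (\<Sum>i<k. x ^ (CARD('f) ^ i))"

text \<open>Frobenius permutes the conjugates cyclically, so it fixes the trace, and
  \<open>range_to_ac\<close> applies.\<close>

lemma GF_trace_in_range:
  fixes x :: "'f::{field,finite} alg_closure"
  assumes "x \<in> GF_ext k"
  shows "GF_trace k x \<in> range to_ac"
proof -
  let ?q = "CARD('f)"
  have "GF_trace k x ^ ?q = (\<Sum>i<k. x ^ (?q ^ Suc i))"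
    unfolding GF_trace_def using sum_power_CARD_power[of "\<lambda>i. x ^ (?q ^ i)" "{..<k}" 1]
    by (simp only: power_one_right power_mult[symmetric] power_Suc2)
  \<comment> \<open>Adding \<open>x\<close> completes the shifted sum to \<open>Suc k\<close> terms,
    whose last term is again \<open>x\<close>.\<close>
  also have "\<dots> + x = (\<Sum>i<Suc k. x ^ (?q ^ i))"
    by (subst sum.lessThan_Suc_shift) (simp only: power_0 power_one_right add.commute)
  also have "\<dots> = GF_trace k x + x"
    using assms by (simp add: GF_trace_def GF_ext_def)
  finally show ?thesis by (simp add: range_to_ac)
qed

lemma linear_GF_trace:
  "Vector_Spaces.linear (\<lambda>c x. to_ac c * x) (\<lambda>c x. to_ac c * x)
     (\<lambda>x. GF_trace k (\<theta> * x) :: 'f::{field,finite} alg_closure)"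
proof unfold_locales
  fix x y :: "'f alg_closure" and c :: 'f
  show "GF_trace k (\<theta> * (x + y)) = GF_trace k (\<theta> * x) + GF_trace k (\<theta> * y)"
    by (simp add: GF_trace_def distrib_left add_power_CARD_power sum.distrib)
  have "(\<theta> * (to_ac c * x)) ^ (CARD('f) ^ i) = to_ac c * (\<theta> * x) ^ (CARD('f) ^ i)" for i
    by (subst mult.left_commute) (simp only: power_mult_distrib to_ac_power_CARD_power)
  then show "GF_trace k (\<theta> * (to_ac c * x)) = to_ac c * GF_trace k (\<theta> * x)"
    by (simp only: GF_trace_def sum_distrib_left)
qed

text \<open>The trace is a nonzero polynomial of degree below \<open>CARD('f) ^ k\<close>, so it
  cannot vanish on all of \<open>GF_ext k\<close>; a nonzero value is then rescaled to 1.\<close>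

lemma exists_GF_trace_eq_1:
  assumes "k > 0"
  shows "\<exists>\<theta>\<in>GF_ext k. GF_trace k \<theta> = (1 :: 'f::{field,finite} alg_closure)"
proof -
  let ?q = "CARD('f)"
  let ?p = "\<Sum>i<k. monom (1 :: 'f alg_closure) (?q ^ i)"
  have q: "?q > 1" by (rule CARD_field_gt_1)
  \<comment> \<open>Only \<open>i = 0\<close> contributes to the linear coefficient, which shows
    that the polynomial is nonzero.\<close>
  have "coeff ?p 1 = (\<Sum>i<k. if i = 0 then 1 else 0)"
    unfolding coeff_sum by (rule sum.cong) (use q in \<open>auto simp: coeff_monom\<close>)
  also have "\<dots> = 1" using assms by simp
  finally have nz: "?p \<noteq> 0" by (metis coeff_0 zero_neq_one)
  have "degree ?p < ?q ^ k"
    by (rule degree_sum_less) (use q in \<open>auto intro: le_less_trans[OF degree_monom_le]\<close>)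
  with card_poly_roots_bound[OF nz] have "card {x. poly ?p x = 0} < card (GF_ext k :: 'f alg_closure set)"
    using assms by (simp add: card_GF_ext)
  then have "\<not> GF_ext k \<subseteq> {x. poly ?p x = 0}"
    using card_mono[OF poly_roots_finite[OF nz]] by (meson leD)
  then obtain x :: "'f alg_closure" where x: "x \<in> GF_ext k" "GF_trace k x \<noteq> 0"
    by (auto simp: poly_sum poly_monom GF_trace_def)
  obtain c where c: "GF_trace k x = to_ac c" using GF_trace_in_range[OF x(1)] by blast
  interpret tr: Vector_Spaces.linear "\<lambda>c x. to_ac c * x" "\<lambda>c x. to_ac c * x"
    "\<lambda>x :: 'f alg_closure. GF_trace k (1 * x)" by (rule linear_GF_trace)
  have "GF_trace k (to_ac (inverse c) * x) = 1"
    using tr.scale[of "inverse c" x] x(2) c by simp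
  moreover have "to_ac (inverse c) * x \<in> GF_ext k" by (intro GF_ext_closed x)
  ultimately show ?thesis by blast
qed

text \<open>The functional is \<open>y \<mapsto> Tr (\<theta> y)\<close> on the subfield, extended arbitrarily to the closure so
  that it is linear on a whole type.\<close>

lemma exists_GF_functional:
  assumes "k > 0"
  shows "\<exists>(T :: 'f::{field,finite} alg_closure \<Rightarrow> 'f) \<theta>.
    Vector_Spaces.linear (\<lambda>c x. to_ac c * x) (*) T \<and> T 1 = 1 \<and>
    (\<forall>y\<in>GF_ext k. to_ac (T y) = GF_trace k (\<theta> * y))"
proof -
  obtain \<theta> :: "'f alg_closure" where \<theta>: "\<theta> \<in> GF_ext k" "GF_trace k \<theta> = 1"
    using exists_GF_trace_eq_1[OF assms] by blast
  let ?F = "GF_ext k :: 'f alg_closure set"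
  \<comment> \<open>Values are prescribed on a maximal independent subset of the subfield; agreement
    with the trace then spreads to its span.\<close>
  obtain B where B: "B \<subseteq> ?F" "ac.independent B" "?F \<subseteq> ac.span B"
    by (rule ac.maximal_independent_subset)
  obtain T where T: "Vector_Spaces.linear (\<lambda>c x. to_ac c * x) (*) T"
      "\<And>b. b \<in> B \<Longrightarrow> T b = of_ac (GF_trace k (\<theta> * b))"
    using ac_scalar.linear_independent_extend[OF B(2), of "\<lambda>b. of_ac (GF_trace k (\<theta> * b))"] by blast
  interpret T: Vector_Spaces.linear "\<lambda>c x. to_ac c * x" "(*)" T by (rule T(1))
  have lin: "Vector_Spaces.linear (\<lambda>c x. to_ac c * x) (\<lambda>c x. to_ac c * x) (\<lambda>y. to_ac (T y))"
    by unfold_locales (simp_all add: T.add T.scale)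
  have "to_ac (T y) = GF_trace k (\<theta> * y)" if "y \<in> ?F" for y
  proof (rule ac_ac.linear_eq_on_span[where f = "\<lambda>y. to_ac (T y)" and g = "\<lambda>y. GF_trace k (\<theta> * y)"])
    show "Vector_Spaces.linear (\<lambda>c x. to_ac c * x) (\<lambda>c x. to_ac c * x) (\<lambda>y. to_ac (T y))"
      by (rule lin)
    show "Vector_Spaces.linear (\<lambda>c x. to_ac c * x) (\<lambda>c x. to_ac c * x) (\<lambda>y. GF_trace k (\<theta> * y))"
      by (rule linear_GF_trace)
    show "y \<in> ac.span B" using B(3) that by blast
    show "to_ac (T b) = GF_trace k (\<theta> * b)" if "b \<in> B" for b
      using that B(1) \<theta>(1) by (auto simp: T(2) intro!: to_ac_of_ac GF_trace_in_range GF_ext_closed)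
  qed
  moreover from this[of 1] have "to_ac (T 1) = to_ac 1"
    using \<theta>(2) by (simp add: GF_ext_closed)
  then have "T 1 = 1" by (simp only: to_ac_eq_iff)
  ultimately show ?thesis using T(1) by (intro exI[of _ T] exI[of _ \<theta>]) simp
qed

section \<open>Polynomial functions on a vector space over a finite field\<close>

locale vector_space_over_finite = vector_space scale
  for scale :: "'f::{field,finite} \<Rightarrow> 'v::ab_group_add \<Rightarrow> 'v" (infixr "*s" 75)
begin

lemma bij_betw_span_insert:
  assumes "b \<notin> span B"
  shows "bij_betw (\<lambda>(t, x). x + t *s b) (UNIV \<times> span B) (span (insert b B))"
proof (rule bij_betw_imageI)
  show "inj_on (\<lambda>(t, x). x + t *s b) (UNIV \<times> span B)"
  proof (rule inj_onI, clarify)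
    fix t x t' x' assume x: "x \<in> span B" "x' \<in> span B" and eq: "x + t *s b = x' + t' *s b"
    have "(t - t') *s b = x' - x" using eq by (simp add: scale_left_diff_distrib algebra_simps)
    then have *: "(t - t') *s b \<in> span B" using x by (simp add: span_diff)
    have "t = t'"
    proof (rule ccontr)
      assume "t \<noteq> t'"
      then have "b = inverse (t - t') *s ((t - t') *s b)" by simp
      then show False using * assms by (metis span_scale)
    qed
    with eq show "t = t' \<and> x = x'" by simp
  qed
  show "(\<lambda>(t, x). x + t *s b) ` (UNIV \<times> span B) = span (insert b B)"
  proof (intro equalityI subsetI)
    fix y assume "y \<in> (\<lambda>(t, x). x + t *s b) ` (UNIV \<times> span B)"
    then obtain t x where "y = x + t *s b" "x \<in> span B" by auto
    then have "y - t *s b \<in> span B" by simp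
    then show "y \<in> span (insert b B)" unfolding span_breakdown_eq by blast
  next
    fix y assume "y \<in> span (insert b B)"
    then obtain t where "y - t *s b \<in> span B" unfolding span_breakdown_eq by blast
    then show "y \<in> (\<lambda>(t, x). x + t *s b) ` (UNIV \<times> span B)"
      by (intro image_eqI[of _ _ "(t, y - t *s b)"]) auto
  qed
qed

lemma card_span:
  assumes "finite B" "independent B"
  shows "card (span B) = CARD('f) ^ card B"
  using assms
proof (induction B rule: finite_induct)
  case (insert b B)
  then have "b \<notin> span B" "independent B" by (auto simp: independent_insert)
  with insert bij_betw_same_card[OF bij_betw_span_insert[of b B]] show ?case
    by (simp add: card_cartesian_product)
qed simp

lemma card_subspace:
  assumes "subspace U" "finite U"
  shows "card U = CARD('f) ^ dim U"
proof -
  obtain B where B: "B \<subseteq> U" "independent B" "U \<subseteq> span B" "card B = dim U"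
    by (rule basis_exists)
  then have "span B = U" using assms(1) by (simp add: span_subspace)
  with card_span[of B] B finite_subset[OF B(1) assms(2)] show ?thesis by simp
qed

section \<open>Chevalley-Warning summation\<close>

abbreviation linear_ac :: "('v \<Rightarrow> 'f alg_closure) \<Rightarrow> bool" where
  "linear_ac \<equiv> Vector_Spaces.linear scale (\<lambda>c x. to_ac c * x)"

text \<open>Induction over the basis: expanding the product at \<open>x + t *s b\<close> over the
  subsets \<open>I\<close> of \<open>J\<close> separates a power sum in \<open>t\<close> from a
  shorter product on \<open>span B\<close>.\<close>

lemma sum_span_prod_linear_ac_eq_0:
  assumes "finite B" "independent B" "finite J" "\<And>j. j \<in> J \<Longrightarrow> linear_ac (l j)"
    and "card J < card B * (CARD('f) - 1)"
  shows "(\<Sum>x\<in>span B. \<Prod>j\<in>J. l j x) = 0"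
  using assms
proof (induction B arbitrary: J rule: finite_induct)
  case (insert b B)
  let ?q = "CARD('f)"
  have b: "b \<notin> span B" "independent B" using insert by (auto simp: independent_insert)
  \<comment> \<open>Either the exponent \<open>card (J - I)\<close> is so small that the power sum
    vanishes, or \<open>I\<close> is small enough for the induction hypothesis.\<close>
  have zero: "(\<Sum>t\<in>UNIV. to_ac t ^ card (J - I)) * (\<Sum>x\<in>span B. \<Prod>j\<in>I. l j x) = 0"
    if I: "I \<subseteq> J" for I
  proof (cases "card (J - I) < ?q - 1")
    case True
    have "(\<Sum>t\<in>UNIV. to_ac t ^ card (J - I)) = to_ac (\<Sum>t::'f\<in>UNIV. t ^ card (J - I))"
      by (simp add: to_ac_sum)
    then show ?thesis using sum_powers_eq_0[OF True] by simp
  next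
    case False
    have "card (J - I) + card I = card J"
      using I insert.prems(2) by (metis card_Diff_subset card_mono finite_subset le_add_diff_inverse2)
    then have "card I < card B * (?q - 1)"
      using False insert.prems(4) insert.hyps by simp
    then have "(\<Sum>x\<in>span B. \<Prod>j\<in>I. l j x) = 0"
      using insert.prems I finite_subset[OF I] by (intro insert.IH b) auto
    then show ?thesis by simp
  qed
  have lin: "l j (x + t *s b) = l j x + to_ac t * l j b" if "j \<in> J" for j t x
  proof -
    interpret l: Vector_Spaces.linear scale "\<lambda>c x. to_ac c * x" "l j" by (rule insert.prems(3)[OF that])
    show ?thesis by (simp add: l.add l.scale)
  qed
  have "(\<Sum>x\<in>span (insert b B). \<Prod>j\<in>J. l j x)
      = (\<Sum>(t, x)\<in>UNIV \<times> span B. \<Prod>j\<in>J. l j (x + t *s b))"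
    by (subst sum.reindex_bij_betw[OF bij_betw_span_insert[OF b(1)], symmetric])
      (simp add: case_prod_unfold)
  also have "\<dots> = (\<Sum>t\<in>UNIV. \<Sum>x\<in>span B. \<Prod>j\<in>J. l j x + to_ac t * l j b)"
    by (simp add: sum.cartesian_product lin)
  also have "\<dots> = (\<Sum>t\<in>UNIV. \<Sum>x\<in>span B. \<Sum>I\<in>Pow J. (\<Prod>j\<in>I. l j x) * (\<Prod>j\<in>J-I. to_ac t * l j b))"
    by (simp add: prod_add insert.prems(2))
  also have "\<dots> = (\<Sum>t\<in>UNIV. \<Sum>I\<in>Pow J. \<Sum>x\<in>span B. (\<Prod>j\<in>I. l j x) * (\<Prod>j\<in>J-I. to_ac t * l j b))"
    by (rule sum.cong[OF refl], rule sum.swap)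
  also have "\<dots> = (\<Sum>I\<in>Pow J. \<Sum>t\<in>UNIV. \<Sum>x\<in>span B. (\<Prod>j\<in>I. l j x) * (\<Prod>j\<in>J-I. to_ac t * l j b))"
    by (rule sum.swap)
  also have "\<dots> = (\<Sum>I\<in>Pow J. (\<Prod>j\<in>J-I. l j b) *
      ((\<Sum>t\<in>UNIV. to_ac t ^ card (J - I)) * (\<Sum>x\<in>span B. \<Prod>j\<in>I. l j x)))"
  proof (rule sum.cong[OF refl])
    fix I
    have "(\<Prod>j\<in>I. l j x) * (\<Prod>j\<in>J-I. to_ac t * l j b)
        = (\<Prod>j\<in>J-I. l j b) * (to_ac t ^ card (J - I) * (\<Prod>j\<in>I. l j x))" for t x
      by (simp only: prod.distrib prod_constant ac_simps)
    then show "(\<Sum>t\<in>UNIV. \<Sum>x\<in>span B. (\<Prod>j\<in>I. l j x) * (\<Prod>j\<in>J-I. to_ac t * l j b))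
        = (\<Prod>j\<in>J-I. l j b) * ((\<Sum>t\<in>UNIV. to_ac t ^ card (J - I)) * (\<Sum>x\<in>span B. \<Prod>j\<in>I. l j x))"
      unfolding sum_product by (simp only: sum_distrib_left)
  qed
  also have "\<dots> = 0"
    by (rule sum.neutral) (use zero in auto)
  finally show ?case .
qed simp

text \<open>The first argument is only an upper bound for the degree.\<close>

inductive poly_fun :: "nat \<Rightarrow> ('v \<Rightarrow> 'f alg_closure) \<Rightarrow> bool" where
  const: "poly_fun d (\<lambda>x. c)"
| linear: "linear_ac l \<Longrightarrow> poly_fun d f \<Longrightarrow> poly_fun (Suc d) (\<lambda>x. l x * f x)"
| add: "poly_fun d f \<Longrightarrow> poly_fun d g \<Longrightarrow> poly_fun d (\<lambda>x. f x + g x)"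

lemma poly_fun_mono: "poly_fun d f \<Longrightarrow> d \<le> e \<Longrightarrow> poly_fun e f"
proof (induction arbitrary: e rule: poly_fun.induct)
  case (const d c)
  show ?case by (rule poly_fun.const)
next
  case (linear l d f)
  then obtain e' where "e = Suc e'" "d \<le> e'" by (cases e) auto
  with linear show ?case using poly_fun.linear[OF linear.hyps(1) linear.IH] by simp
next
  case (add d f g)
  show ?case by (rule poly_fun.add[OF add.IH]) (fact add.prems)+
qed

lemma poly_fun_linear: "linear_ac l \<Longrightarrow> poly_fun 1 l"
  using linear[OF _ const[of 0 1]] by simp

lemma poly_fun_cmult: "poly_fun d f \<Longrightarrow> poly_fun d (\<lambda>x. c * f x)"
proof (induction rule: poly_fun.induct)
  case (const d c')
  show ?case by (rule poly_fun.const)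
next
  case (linear l d f)
  show ?case using poly_fun.linear[OF linear.hyps(1) linear.IH] by (simp only: mult.left_commute)
next
  case (add d f g)
  show ?case using poly_fun.add[OF add.IH] by (simp only: distrib_left)
qed

lemma poly_fun_mult:
  assumes "poly_fun d f" "poly_fun e g"
  shows "poly_fun (d + e) (\<lambda>x. f x * g x)"
  using assms
proof (induction rule: poly_fun.induct)
  case (const d c)
  show ?case by (rule poly_fun_mono[OF poly_fun_cmult[OF const]]) simp
next
  case (linear l d f)
  show ?case using poly_fun.linear[OF linear.hyps(1) linear.IH[OF linear.prems]]
    by (simp only: mult.assoc add_Suc)
next
  case (add d f f')
  show ?case using poly_fun.add[OF add.IH[OF add.prems]] by (simp only: distrib_right)
qed

lemma poly_fun_power: "poly_fun d f \<Longrightarrow> poly_fun (m * d) (\<lambda>x. f x ^ m)"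
proof (induction m)
  case 0
  show ?case unfolding power_0 by (rule const)
next
  case (Suc m)
  show ?case using poly_fun_mult[OF Suc.prems Suc.IH[OF Suc.prems]] by simp
qed

lemma poly_fun_prod:
  "finite A \<Longrightarrow> (\<And>i. i \<in> A \<Longrightarrow> poly_fun d (f i)) \<Longrightarrow> poly_fun (card A * d) (\<lambda>x. \<Prod>i\<in>A. f i x)"
proof (induction A rule: finite_induct)
  case empty
  show ?case unfolding prod.empty by (rule const)
next
  case (insert i A)
  then have "poly_fun (d + card A * d) (\<lambda>x. f i x * (\<Prod>i\<in>A. f i x))"
    by (intro poly_fun_mult) simp_all
  with insert.hyps show ?case by simp
qed

lemma poly_fun_sum:
  "finite A \<Longrightarrow> (\<And>i. i \<in> A \<Longrightarrow> poly_fun d (f i)) \<Longrightarrow> poly_fun d (\<lambda>x. \<Sum>i\<in>A. f i x)"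
proof (induction A rule: finite_induct)
  case empty
  show ?case unfolding sum.empty by (rule const)
next
  case (insert i A)
  then have "poly_fun d (\<lambda>x. f i x + (\<Sum>i\<in>A. f i x))"
    by (intro poly_fun.add) simp_all
  with insert.hyps show ?case by simp
qed

theorem sum_poly_fun_eq_0:
  assumes U: "subspace U" "finite U" and "poly_fun d f" "d < dim U * (CARD('f) - 1)"
  shows "(\<Sum>x\<in>U. f x) = 0"
proof -
  obtain B where B: "B \<subseteq> U" "independent B" "U \<subseteq> span B" "card B = dim U"
    by (rule basis_exists)
  then have span: "span B = U" and "finite B"
    using U by (auto simp: span_subspace intro: finite_subset)
  \<comment> \<open>Generalized for the induction: \<open>ls\<close> holds the linear factors
    already peeled off, and its length is charged against the degree bound.\<close>
  have *: "(\<Sum>x\<in>U. (\<Prod>l\<leftarrow>ls. l x) * f x) = 0"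
    if "poly_fun d f" "\<forall>l\<in>set ls. linear_ac l" "length ls + d < dim U * (CARD('f) - 1)" for ls
    using that
  proof (induction arbitrary: ls rule: poly_fun.induct)
    case (const d c)
    have "(\<Sum>x\<in>span B. \<Prod>j\<in>{..<length ls}. (ls ! j) x) = 0"
    proof (rule sum_span_prod_linear_ac_eq_0[OF \<open>finite B\<close> B(2)])
      show "card {..<length ls} < card B * (CARD('f) - 1)" using const(2) B(4) by simp
    qed (use const(1) in simp_all)
    moreover have "(\<Prod>l\<leftarrow>ls. l x) = (\<Prod>j\<in>{..<length ls}. (ls ! j) x)" for x
      by (simp add: prod.list_conv_set_nth atLeast0LessThan)
    ultimately show ?case unfolding span by (simp only: sum_distrib_right[symmetric] mult_zero_left)
  next
    case (linear l d f)
    have "(\<Sum>x\<in>U. (\<Prod>l\<leftarrow>l # ls. l x) * f x) = 0"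
      by (rule linear.IH) (use linear.prems linear.hyps(1) in simp_all)
    moreover have "(\<Prod>l\<leftarrow>l # ls. l x) * f x = (\<Prod>l\<leftarrow>ls. l x) * (l x * f x)" for x
      by (simp only: list.map prod_list.Cons mult.assoc mult.left_commute[of _ "l x"])
    ultimately show ?case by (simp only:)
  next
    case (add d f g)
    then show ?case by (simp only: distrib_left sum.distrib add_0)
  qed
  have "(\<Sum>x\<in>U. (\<Prod>l\<leftarrow>[]. l x) * f x) = 0" by (rule *) (use assms in auto)
  then show ?thesis by simp
qed

end

section \<open>Isometries of alternating spaces modulo the radical\<close>

locale alternating_space = vector_space scale
  for scale :: "'f::field \<Rightarrow> 'v::ab_group_add \<Rightarrow> 'v" (infixr "*s" 75) +
  fixes form :: "'v \<Rightarrow> 'v \<Rightarrow> 'f"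
  assumes form_linear_left: "\<And>w. Vector_Spaces.linear scale (*) (\<lambda>v. form v w)"
    and form_linear_right: "\<And>v. Vector_Spaces.linear scale (*) (\<lambda>w. form v w)"
    and form_alternating: "\<And>v. form v v = 0"
begin

sublocale left: Vector_Spaces.linear scale "(*)" "\<lambda>v. form v w" for w
  by (rule form_linear_left)

sublocale right: Vector_Spaces.linear scale "(*)" "\<lambda>w. form v w" for v
  by (rule form_linear_right)

lemma form_commute: "form v w = - form w v"
proof -
  have "form v w + form w v = form (v + w) (v + w)"
    unfolding left.add right.add by (simp add: form_alternating)
  then show ?thesis
    by (simp add: form_alternating eq_neg_iff_add_eq_0)
qed

section \<open>Hyperbolic pairs, orthogonal projection and the radical\<close>

definition hyperbolic :: "nat \<Rightarrow> (nat \<Rightarrow> 'v) \<Rightarrow> (nat \<Rightarrow> 'v) \<Rightarrow> bool" where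
  "hyperbolic m e f \<longleftrightarrow> (\<forall>i<m. \<forall>j<m. form (e i) (e j) = 0 \<and> form (f i) (f j) = 0 \<and>
     form (e i) (f j) = of_bool (i = j))"

text \<open>The minus sign offsets \<open>form (f j) (e j) = - 1\<close>, so that pairing with
  \<open>f j\<close> and \<open>e j\<close> returns \<open>a j\<close> and \<open>b j\<close>. Hence
  \<open>proj\<close> is the orthogonal projection onto the span of the pairs.\<close>

definition comb :: "nat \<Rightarrow> (nat \<Rightarrow> 'v) \<Rightarrow> (nat \<Rightarrow> 'v) \<Rightarrow> (nat \<Rightarrow> 'f) \<Rightarrow> (nat \<Rightarrow> 'f) \<Rightarrow> 'v" where
  "comb m e f a b = (\<Sum>i<m. a i *s e i - b i *s f i)"

abbreviation proj :: "nat \<Rightarrow> (nat \<Rightarrow> 'v) \<Rightarrow> (nat \<Rightarrow> 'v) \<Rightarrow> 'v \<Rightarrow> 'v" where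
  "proj m e f v \<equiv> comb m e f (\<lambda>i. form v (f i)) (\<lambda>i. form v (e i))"

definition radical :: "'v set \<Rightarrow> 'v set" where
  "radical S = {v \<in> S. \<forall>w\<in>S. form v w = 0}"

lemma form_comb_right:
  "form v (comb m e f a b) = (\<Sum>i<m. a i * form v (e i) - b i * form v (f i))"
  by (simp add: comb_def right.sum right.diff right.scale)

lemma form_comb:
  assumes "hyperbolic m e f" "j < m"
  shows "form (comb m e f a b) (f j) = a j" "form (comb m e f a b) (e j) = b j"
proof -
  have fe: "form (f i) (e j) = - of_bool (i = j)" if "i < m" for i
    using assms that form_commute[of "f i" "e j"] by (auto simp: hyperbolic_def)
  have delta: "(\<Sum>i<m. c i * of_bool (i = j)) = c j" for c :: "nat \<Rightarrow> 'f"
  proof -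
    have "{..<m} \<inter> {i. i = j} = {j}" using assms(2) by auto
    then show ?thesis by (simp add: sum_mult_of_bool_eq)
  qed
  have "form (comb m e f a b) (f j) = (\<Sum>i<m. a i * of_bool (i = j))"
    using assms by (simp add: comb_def left.sum left.diff left.scale hyperbolic_def)
  then show "form (comb m e f a b) (f j) = a j" by (simp only: delta)
  have "form (comb m e f a b) (e j) = (\<Sum>i<m. b i * of_bool (i = j))"
    using assms fe by (simp add: comb_def left.sum left.diff left.scale hyperbolic_def)
  then show "form (comb m e f a b) (e j) = b j" by (simp only: delta)
qed

lemma comb_in_subspace:
  assumes "subspace S" "\<And>i. i < m \<Longrightarrow> e i \<in> S \<and> f i \<in> S"
  shows "comb m e f a b \<in> S"
  unfolding comb_def using assms by (intro subspace_sum subspace_diff subspace_scale) auto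

text \<open>A largest hyperbolic system in \<open>S\<close> is taken. A remainder
  \<open>v - proj m e f v\<close> outside the radical would supply one more pair.\<close>

lemma exists_maximal_hyperbolic:
  assumes S: "subspace S" "finite S"
  shows "\<exists>m e f. hyperbolic m e f \<and> (\<forall>i<m. e i \<in> S \<and> f i \<in> S) \<and>
    (\<forall>v\<in>S. v - proj m e f v \<in> radical S)"
proof -
  define P where "P m \<longleftrightarrow> (\<exists>e f. hyperbolic m e f \<and> (\<forall>i<m. e i \<in> S \<and> f i \<in> S))" for m
  \<comment> \<open>Pairing with the \<open>f i\<close> separates the \<open>e i\<close>, so the
    finite \<open>S\<close> bounds \<open>m\<close>.\<close>
  have bound: "m \<le> card S" if "P m" for m
  proof -
    from that obtain e f where ef: "hyperbolic m e f" "\<forall>i<m. e i \<in> S \<and> f i \<in> S"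
      unfolding P_def by blast
    have "inj_on e {..<m}"
    proof (rule inj_onI)
      fix i j assume ij: "i \<in> {..<m}" "j \<in> {..<m}" "e i = e j"
      have "(1::'f) = form (e j) (f i)" unfolding ij(3)[symmetric] using ij(1) ef(1) by (simp add: hyperbolic_def)
      also have "\<dots> = of_bool (j = i)" using ij(1,2) ef(1) unfolding hyperbolic_def by blast
      finally show "i = j" by (auto simp: of_bool_def split: if_splits)
    qed
    then have "card {..<m} \<le> card S"
      using ef(2) S(2) by (intro card_inj_on_le) auto
    then show ?thesis by simp
  qed
  have "P 0" by (simp add: P_def hyperbolic_def)
  then obtain m where m: "P m" "\<And>m'. P m' \<Longrightarrow> m' \<le> m"
    using bound by (metis GreatestI_nat Greatest_le_nat)
  from m(1) obtain e f where ef: "hyperbolic m e f" "\<And>i. i < m \<Longrightarrow> e i \<in> S \<and> f i \<in> S"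
    unfolding P_def by blast
  have "v - proj m e f v \<in> radical S" if v: "v \<in> S" for v
  proof (rule ccontr)
    define r where "r v = v - proj m e f v" for v
    have r_in: "r v \<in> S" if "v \<in> S" for v
      using that ef(2) S(1) by (auto simp: r_def intro: subspace_diff comb_in_subspace)
    have r_perp: "form (r v) (e j) = 0" "form (r v) (f j) = 0" if "j < m" for v j
      using that ef(1) by (simp_all add: r_def left.diff form_comb)
    assume "v - proj m e f v \<notin> radical S"
    with r_in[OF v] obtain w where w: "w \<in> S" "form (r v) w \<noteq> 0"
      by (auto simp: radical_def r_def)
    \<comment> \<open>Passing from \<open>w\<close> to its remainder keeps the value, because
      \<open>r v\<close> is orthogonal to every pair.\<close>
    have "form (r v) (r w) = form (r v) w - form (r v) (proj m e f w)"
      by (simp add: r_def[of w] right.diff)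
    also have "form (r v) (proj m e f w) = 0"
      by (simp add: form_comb_right r_perp)
    finally have rvw: "form (r v) (r w) = form (r v) w" by simp
    define w' where "w' = inverse (form (r v) w) *s r w"
    have w': "w' \<in> S" "form (r v) w' = 1"
      using r_in[OF w(1)] S(1) w(2) rvw by (simp_all add: w'_def subspace_scale right.scale)
    have w'_perp: "form w' (e j) = 0" "form w' (f j) = 0" if "j < m" for j
      using that r_perp by (simp_all add: w'_def left.scale)
    have perp': "form (e j) (r v) = 0" "form (f j) (r v) = 0" "form (e j) w' = 0" "form (f j) w' = 0"
      if "j < m" for j
      using r_perp[OF that, of v] w'_perp[OF that] by (metis form_commute neg_equal_0_iff_equal)+
    have "hyperbolic (Suc m) (e(m := r v)) (f(m := w'))"
      using ef(1) r_perp w'_perp perp' w'(2)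
      by (auto simp: hyperbolic_def less_Suc_eq form_alternating)
    then have "P (Suc m)"
      unfolding P_def using ef(2) r_in[OF v] w'(1)
      by (intro exI[of _ "e(m := r v)"] exI[of _ "f(m := w')"]) (auto simp: less_Suc_eq)
    with m(2) show False by fastforce
  qed
  with ef show ?thesis by (intro exI[of _ m] exI[of _ e] exI[of _ f] conjI) auto
qed

text \<open>The pairs give \<open>2 * m\<close> free coordinates, and the remainder after projection
  ranges freely over the radical.\<close>

lemma card_eq_card_radical_mult:
  assumes S: "subspace S" "finite S"
    and ef: "hyperbolic m e f" "\<And>i. i < m \<Longrightarrow> e i \<in> S \<and> f i \<in> S"
    and proj: "\<And>v. v \<in> S \<Longrightarrow> v - proj m e f v \<in> radical S"
  shows "card S = card (radical S) * (CARD('f) ^ m * CARD('f) ^ m)"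
proof -
  let ?A = "{..<m} \<rightarrow>\<^sub>E (UNIV :: 'f set)"
  \<comment> \<open>\<open>restrict\<close> normalizes the coordinate functions, which matter only
    below \<open>m\<close>.\<close>
  let ?h = "\<lambda>v. (v - proj m e f v, restrict (\<lambda>i. form v (f i)) {..<m}, restrict (\<lambda>i. form v (e i)) {..<m})"
  let ?g = "\<lambda>(r, a, b). r + comb m e f a b"
  have comb_cong: "comb m e f a b = comb m e f a' b'"
    if "\<And>i. i < m \<Longrightarrow> a i = a' i" "\<And>i. i < m \<Longrightarrow> b i = b' i" for a b a' b'
    using that by (simp add: comb_def)
  have "bij_betw ?h S (radical S \<times> ?A \<times> ?A)"
  proof (rule bij_betw_byWitness[where f' = ?g])
    show "\<forall>v\<in>S. ?g (?h v) = v"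
      by (auto intro: comb_cong)
    show "\<forall>t\<in>radical S \<times> ?A \<times> ?A. ?h (?g t) = t"
    proof
      fix t assume "t \<in> radical S \<times> ?A \<times> ?A"
      then obtain r a b where t: "t = (r, a, b)" "r \<in> radical S" "a \<in> ?A" "b \<in> ?A" by auto
      have *: "form (r + comb m e f a b) (f i) = a i" "form (r + comb m e f a b) (e i) = b i" if "i < m" for i
        using that t(2) ef(2) by (auto simp: left.add form_comb[OF ef(1)] radical_def)
      have "proj m e f (r + comb m e f a b) = comb m e f a b"
        by (rule comb_cong) (simp_all add: *)
      moreover have "restrict (\<lambda>i. form (r + comb m e f a b) (f i)) {..<m} = a"
        using t(3) * by (intro extensionalityI[of _ "{..<m}"]) (auto simp: PiE_def)
      moreover have "restrict (\<lambda>i. form (r + comb m e f a b) (e i)) {..<m} = b"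
        using t(4) * by (intro extensionalityI[of _ "{..<m}"]) (auto simp: PiE_def)
      ultimately show "?h (?g t) = t" by (simp add: t(1))
    qed
    show "?h ` S \<subseteq> radical S \<times> ?A \<times> ?A"
    proof (rule image_subsetI)
      fix v assume "v \<in> S"
      then have "v - proj m e f v \<in> radical S" by (rule proj)
      moreover have "restrict a {..<m} \<in> ?A" for a :: "nat \<Rightarrow> 'f" by (simp only: restrict_PiE_iff) simp
      ultimately show "?h v \<in> radical S \<times> ?A \<times> ?A" by blast
    qed
    show "?g ` (radical S \<times> ?A \<times> ?A) \<subseteq> S"
      using S(1) ef(2) by (auto simp: radical_def intro!: subspace_add comb_in_subspace)
  qed
  then show ?thesis
    by (simp add: bij_betw_same_card card_cartesian_product card_PiE)
qed

end

section \<open>Comparison of two alternating spaces\<close>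

locale alternating_space_pair =
  s1: alternating_space scale1 form1 + s2: alternating_space scale2 form2
  for scale1 :: "'f::{field,finite} \<Rightarrow> 'v::ab_group_add \<Rightarrow> 'v" and form1
    and scale2 :: "'f \<Rightarrow> 'w::ab_group_add \<Rightarrow> 'w" and form2
begin

text \<open>Counting forces maximal hyperbolic systems on both sides to have equally many pairs;
  \<open>\<phi>\<close> copies the coordinates and so kills the radical.\<close>

lemma exists_isometry_mod_radical:
  assumes S1: "s1.subspace S1" "finite S1" and S2: "s2.subspace S2" "finite S2"
    and rad2: "s2.radical S2 = {0}"
    and card: "card S1 = card (s1.radical S1) * card S2"
  shows "\<exists>\<phi>. Vector_Spaces.linear scale1 scale2 \<phi> \<and> \<phi> ` S1 = S2 \<and>
    (\<forall>v\<in>S1. \<forall>w\<in>S1. form2 (\<phi> v) (\<phi> w) = form1 v w)"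
proof -
  obtain m e f where 1: "s1.hyperbolic m e f" "\<And>i. i < m \<Longrightarrow> e i \<in> S1 \<and> f i \<in> S1"
    "\<And>v. v \<in> S1 \<Longrightarrow> v - s1.proj m e f v \<in> s1.radical S1"
    using s1.exists_maximal_hyperbolic[OF S1] by blast
  obtain m' e' f' where 2: "s2.hyperbolic m' e' f'" "\<And>i. i < m' \<Longrightarrow> e' i \<in> S2 \<and> f' i \<in> S2"
    "\<And>v. v \<in> S2 \<Longrightarrow> v - s2.proj m' e' f' v \<in> s2.radical S2"
    using s2.exists_maximal_hyperbolic[OF S2] by blast
  have "0 \<in> s1.radical S1" using S1(1) by (simp add: s1.radical_def s1.subspace_0 s1.left.zero)
  moreover have "finite (s1.radical S1)" using S1(2) by (simp add: s1.radical_def)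
  ultimately have "card (s1.radical S1) > 0" by (auto simp: card_gt_0_iff)
  then have "CARD('f) ^ (m + m) = CARD('f) ^ (m' + m')"
    using card s1.card_eq_card_radical_mult[OF S1 1] s2.card_eq_card_radical_mult[OF S2 2]
    by (simp add: rad2 power_add)
  moreover have "CARD('f) > 1"
    using card_mono[of UNIV "{0, 1::'f}"] by simp
  ultimately have [simp]: "m' = m" by (simp add: power_inject_exp)
  define \<phi> where "\<phi> v = s2.comb m e' f' (\<lambda>i. form1 v (f i)) (\<lambda>i. form1 v (e i))" for v
  have lin: "Vector_Spaces.linear scale1 scale2 \<phi>"
  proof unfold_locales
    show "\<phi> (x + y) = \<phi> x + \<phi> y" for x y
      by (simp add: \<phi>_def s2.comb_def s1.left.add s2.scale_left_distrib sum.distrib sum_subtractf)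
    show "\<phi> (scale1 c x) = scale2 c (\<phi> x)" for c x
      by (simp add: \<phi>_def s2.comb_def s1.left.scale s2.scale_sum_right s2.scale_right_diff_distrib)
  qed
  have iso: "form2 (\<phi> v) (\<phi> w) = form1 v w" if "v \<in> S1" "w \<in> S1" for v w
  proof -
    \<comment> \<open>\<open>w\<close> and its projection differ by a radical element, so they pair
      equally with \<open>v\<close>.\<close>
    have "form1 (w - s1.proj m e f w) v = 0"
      using 1(3)[OF that(2)] that(1) by (simp add: s1.radical_def)
    then have "form1 v w = form1 v (s1.proj m e f w)"
      using s1.form_commute[of w v] s1.form_commute[of "s1.proj m e f w" v]
      by (simp only: s1.left.diff) simp
    also have "\<dots> = form2 (\<phi> v) (\<phi> w)"
      using 2(1) unfolding s1.form_comb_right \<phi>_def[of w] s2.form_comb_right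
      by (intro sum.cong) (simp_all add: \<phi>_def s2.form_comb)
    finally show ?thesis by simp
  qed
  have "\<phi> ` S1 = S2"
  proof
    show "\<phi> ` S1 \<subseteq> S2" using S2(1) 2(2) by (auto simp: \<phi>_def intro!: s2.comb_in_subspace)
    show "S2 \<subseteq> \<phi> ` S1"
    proof
      fix u assume u: "u \<in> S2"
      let ?x = "s1.comb m e f (\<lambda>i. form2 u (f' i)) (\<lambda>i. form2 u (e' i))"
      have "\<phi> ?x = s2.proj m e' f' u"
        unfolding \<phi>_def s2.comb_def by (rule sum.cong) (simp_all add: s1.form_comb[OF 1(1)])
      also have "\<dots> = u" using 2(3)[OF u] rad2 by simp
      finally show "u \<in> \<phi> ` S1"
        using S1(1) 1(2) by (intro image_eqI[of _ _ ?x]) (auto intro!: s1.comb_in_subspace)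
    qed
  qed
  with lin iso show ?thesis by (intro exI[of _ \<phi>]) simp
qed

end

section \<open>The determinant quadric\<close>

text \<open>A quadruple \<open>(a, b, c, d)\<close> stands for the matrix with rows \<open>(a, b)\<close> and \<open>(c, d)\<close>; signs are dropped
  because the characteristic will be 2.\<close>

type_synonym 'f quad = "'f alg_closure \<times> 'f alg_closure \<times> 'f alg_closure \<times> 'f alg_closure"

fun scale4 :: "'f::field \<Rightarrow> 'f quad \<Rightarrow> 'f quad" where
  "scale4 r (a, b, c, d) = (to_ac r * a, to_ac r * b, to_ac r * c, to_ac r * d)"

interpretation quad: vector_space_over_finite "scale4 :: 'f::{field,finite} \<Rightarrow> _"
  by unfold_locales (auto simp: distrib_left distrib_right)

section \<open>Degrees of powers of the determinant\<close>

fun det4 :: "'f::field quad \<Rightarrow> 'f alg_closure" where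
  "det4 (a, b, c, d) = a * d + b * c"

text \<open>All \<open>i\<close> base-\<open>q\<close> digits of \<open>q ^ i - 1\<close> are
  \<open>q - 1\<close>. Splitting off Frobenius powers in this way keeps the degree over the base
  field low.\<close>

lemma power_CARD_power_minus_1:
  fixes y :: "'a::comm_monoid_mult"
  assumes "q > 0"
  shows "y ^ (q ^ i - 1) = (\<Prod>l<i. (y ^ (q ^ l)) ^ (q - 1))"
proof (induction i)
  case (Suc i)
  have "q ^ i > 0" using assms by simp
  then have "q ^ i \<le> q ^ Suc i" using assms by simp
  then have "q ^ Suc i - 1 = (q ^ i - 1) + (q ^ Suc i - q ^ i)"
    using \<open>q ^ i > 0\<close> by linarith
  also have "q ^ Suc i - q ^ i = q ^ i * (q - 1)"
    by (simp add: diff_mult_distrib2 mult.commute)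
  finally have "q ^ Suc i - 1 = (q ^ i - 1) + q ^ i * (q - 1)" .
  then show ?case using Suc.IH by (simp only: prod.lessThan_Suc power_add power_mult)
qed simp

text \<open>Frobenius fixes the base field, so these maps are linear over it; they are the reason
  for letting \<open>linear_ac\<close> take values in the closure.\<close>

lemma linear_ac_quad:
  "quad.linear_ac (\<lambda>(a, b, c, d). a ^ (CARD('f) ^ l) :: 'f::{field,finite} alg_closure)"
  "quad.linear_ac (\<lambda>(a, b, c, d). b ^ (CARD('f) ^ l) :: 'f::{field,finite} alg_closure)"
  "quad.linear_ac (\<lambda>(a, b, c, d). c ^ (CARD('f) ^ l) :: 'f::{field,finite} alg_closure)"
  "quad.linear_ac (\<lambda>(a, b, c, d). d ^ (CARD('f) ^ l) :: 'f::{field,finite} alg_closure)"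
  by (unfold_locales; auto simp: add_power_CARD_power power_mult_distrib)+

text \<open>The degree is 2 for every \<open>l\<close>: the Frobenius power passes to the
  coordinates.\<close>

lemma poly_fun_det4_power:
  "quad.poly_fun 2 (\<lambda>x :: 'f::{field,finite} quad. (\<theta> * det4 x) ^ (CARD('f) ^ l))"
proof -
  let ?Q = "CARD('f) ^ l"
  let ?a = "\<lambda>(a, b, c, d). a ^ ?Q :: 'f alg_closure" and ?b = "\<lambda>(a, b, c, d). b ^ ?Q :: 'f alg_closure"
  let ?c = "\<lambda>(a, b, c, d). c ^ ?Q :: 'f alg_closure" and ?d = "\<lambda>(a, b, c, d). d ^ ?Q :: 'f alg_closure"
  have "quad.poly_fun (1 + 1) (\<lambda>x. \<theta> ^ ?Q * (?a x * ?d x + ?b x * ?c x))"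
    by (intro quad.poly_fun_cmult quad.poly_fun.add quad.poly_fun_mult quad.poly_fun_linear linear_ac_quad)
  also have "(\<lambda>x. \<theta> ^ ?Q * (?a x * ?d x + ?b x * ?c x)) = (\<lambda>x. (\<theta> * det4 x) ^ ?Q)"
    by (auto simp: fun_eq_iff power_mult_distrib add_power_CARD_power)
  finally show ?thesis by (simp add: numeral_2_eq_2)
qed

text \<open>Each of the \<open>i\<close> Frobenius powers has degree 2 and is raised to
  \<open>CARD('f) - 1\<close>, instead of the naive degree
  \<open>2 * (CARD('f) ^ i - 1)\<close>.\<close>

lemma poly_fun_det4:
  "quad.poly_fun (i * ((CARD('f) - 1) * 2)) (\<lambda>x :: 'f::{field,finite} quad. (\<theta> * det4 x) ^ (CARD('f) ^ i - 1))"
proof -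
  have "quad.poly_fun (card {..<i} * ((CARD('f) - 1) * 2))
      (\<lambda>x :: 'f quad. \<Prod>l<i. ((\<theta> * det4 x) ^ (CARD('f) ^ l)) ^ (CARD('f) - 1))"
    by (intro quad.poly_fun_prod quad.poly_fun_power poly_fun_det4_power) simp
  then show ?thesis by (simp only: card_lessThan power_CARD_power_minus_1[OF zero_less_card_finite])
qed

locale trace_cone =
  fixes k :: nat and T :: "'f::{field,finite} alg_closure \<Rightarrow> 'f" and \<theta> :: "'f alg_closure"
  assumes k_pos: "k > 0" and even_CARD: "even (CARD('f))"
    and T_linear: "Vector_Spaces.linear (\<lambda>c x. to_ac c * x) (*) T"
    and T_1: "T 1 = 1"
    and T_trace: "\<And>y. y \<in> GF_ext k \<Longrightarrow> to_ac (T y) = GF_trace k (\<theta> * y)"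
begin

sublocale T: Vector_Spaces.linear "\<lambda>c x. to_ac c * x" "(*)" T
  by (rule T_linear)

abbreviation F :: "'f alg_closure set" where "F \<equiv> GF_ext k"

lemma T_to_ac: "T (to_ac c) = c"
  using T.scale[of c 1] by (simp add: T_1)

lemma add_self_scalar [simp]: "x + x = (0 :: 'f)"
  using two_eq_0_if_even_CARD[OF even_CARD] by (metis distrib_left mult.right_neutral mult_zero_right)

lemma add_self [simp]: "x + x = (0 :: 'f alg_closure)"
proof -
  have "(1 :: 'f alg_closure) + 1 = to_ac (1 + 1)" by (simp only: to_ac_add to_ac_1)
  then have "(1 :: 'f alg_closure) + 1 = 0" by simp
  then show ?thesis by (metis distrib_left mult.right_neutral mult_zero_right)
qed

lemma add_self_left [simp]: "x + (x + y) = (y :: 'f alg_closure)"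
  by (simp flip: add.assoc)

lemma two_eq_0 [simp]: "(2 :: 'f alg_closure) = 0"
  by (simp flip: one_add_one)

lemma minus_eq_scalar: "- x = (x :: 'f)"
  by (simp add: minus_unique)

lemma add_eq_0_iff' [simp]: "x + y = 0 \<longleftrightarrow> x = (y :: 'f alg_closure)"
  by (auto simp: add_eq_0_iff)

text \<open>The test element \<open>1 / x\<close> would give \<open>T 1 = 0\<close>.\<close>

lemma T_nondegenerate:
  assumes "x \<in> F" "\<And>y. y \<in> F \<Longrightarrow> T (x * y) = 0"
  shows "x = 0"
proof (rule ccontr)
  assume "x \<noteq> 0"
  moreover have "1 / x \<in> F" using assms(1) by (intro GF_ext_closed)
  ultimately show False using assms(2)[of "1 / x"] T_1 by simp
qed

section \<open>The kernel of \<open>T\<close>, the polar form and the complement of the identity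
  matrix\<close>

definition H :: "'f alg_closure set" where "H = {h \<in> F. T h = 0}"

text \<open>\<open>F\<close> is the direct sum of the scalars and \<open>H\<close>: the scalar part
  of \<open>y\<close> is \<open>to_ac (T y)\<close>.\<close>

lemma card_F_eq: "CARD('f) * card H = CARD('f) ^ k"
proof -
  have "bij_betw (\<lambda>(t, h). to_ac t + h) (UNIV \<times> H) F"
  proof (rule bij_betw_byWitness[where f' = "\<lambda>y. (T y, to_ac (T y) + y)"])
    show "\<forall>a\<in>UNIV \<times> H. (T (case a of (t, h) \<Rightarrow> to_ac t + h),
        to_ac (T (case a of (t, h) \<Rightarrow> to_ac t + h)) + (case a of (t, h) \<Rightarrow> to_ac t + h)) = a"
      by (auto simp: H_def T.add T_to_ac)
    show "\<forall>y\<in>F. (case (T y, to_ac (T y) + y) of (t, h) \<Rightarrow> to_ac t + h) = y" by simp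
    show "(\<lambda>(t, h). to_ac t + h) ` (UNIV \<times> H) \<subseteq> F" by (auto simp: H_def GF_ext_closed)
    show "(\<lambda>y. (T y, to_ac (T y) + y)) ` F \<subseteq> UNIV \<times> H" by (auto simp: H_def T.add T_to_ac GF_ext_closed)
  qed
  from bij_betw_same_card[OF this] show ?thesis
    by (simp add: card_cartesian_product card_GF_ext[OF k_pos])
qed

text \<open>The polar form of the quadratic form \<open>T (det4 x)\<close>, as \<open>Q_add\<close>
  confirms.\<close>

fun cone_form :: "'f quad \<Rightarrow> 'f quad \<Rightarrow> 'f" where
  "cone_form (a, b, c, d) (a', b', c', d') = T (a * d' + d * a' + b * c' + c * b')"

sublocale cone: alternating_space scale4 cone_form
proof (intro alternating_space.intro alternating_space_axioms.intro)
  show "vector_space (scale4 :: 'f \<Rightarrow> _)" by (rule quad.vector_space_axioms)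
  show "Vector_Spaces.linear scale4 (*) (\<lambda>v. cone_form v w)" for w
  proof unfold_locales
    fix r x y
    show "cone_form (x + y) w = cone_form x w + cone_form y w"
      by (cases x; cases y; cases w) (simp add: distrib_right distrib_left T.add ac_simps)
    show "cone_form (scale4 r x) w = r * cone_form x w"
      by (cases x; cases w) (simp only: scale4.simps cone_form.simps mult.assoc mult.left_commute[of _ "to_ac r"]
        distrib_left[symmetric] T.scale)
  qed
  show "Vector_Spaces.linear scale4 (*) (\<lambda>w. cone_form v w)" for v
  proof unfold_locales
    fix r x y
    show "cone_form v (x + y) = cone_form v x + cone_form v y"
      by (cases x; cases y; cases v) (simp add: distrib_right distrib_left T.add ac_simps)
    show "cone_form v (scale4 r x) = r * cone_form v x"
      by (cases x; cases v) (simp only: scale4.simps cone_form.simps mult.assoc mult.left_commute[of _ "to_ac r"]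
        distrib_left[symmetric] T.scale)
  qed
  show "cone_form v v = 0" for v
    by (cases v) (simp add: mult.commute add.assoc T.zero)
qed

text \<open>The matrices over \<open>F\<close> orthogonal to the identity matrix:
  \<open>T (a + d)\<close> is the value of \<open>cone_form\<close> at \<open>(1, 0, 0, 1)\<close>
  and \<open>(a, b, c, d)\<close>.\<close>

definition N :: "'f quad set" where
  "N = {(a, b, c, d) | a b c d. a \<in> F \<and> b \<in> F \<and> c \<in> F \<and> d \<in> F \<and> T (a + d) = 0}"

lemma N_iff: "(a, b, c, d) \<in> N \<longleftrightarrow> a \<in> F \<and> b \<in> F \<and> c \<in> F \<and> d \<in> F \<and> T (a + d) = 0"
  by (auto simp: N_def)

lemma subspace_N: "quad.subspace N"
  unfolding quad.subspace_def
proof (intro conjI ballI allI)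
  show "0 \<in> N" by (simp add: zero_prod_def N_iff GF_ext_closed T.zero)
  show "x + y \<in> N" if "x \<in> N" "y \<in> N" for x y
  proof -
    obtain a b c d a' b' c' d' where xy: "x = (a, b, c, d)" "y = (a', b', c', d')"
      by (cases x, cases y)
    have "T ((a + a') + (d + d')) = T (a + d) + T (a' + d')" by (simp add: T.add ac_simps)
    with that show ?thesis by (simp add: xy N_iff GF_ext_closed)
  qed
  show "scale4 r x \<in> N" if "x \<in> N" for r x
    using that by (cases x) (auto simp: N_iff GF_ext_closed T.add T.scale simp flip: distrib_left)
qed

lemma finite_N: "finite N"
  by (rule finite_subset[of _ "F \<times> F \<times> F \<times> F"])
    (use finite_GF_ext[OF k_pos, where 'f='f] in \<open>auto simp: N_def\<close>)

text \<open>Writing \<open>d = a + h\<close> with \<open>h\<close> in \<open>H\<close> leaves three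
  free entries. The extra factor \<open>CARD('f)\<close> avoids a subtraction in the
  exponent.\<close>

lemma card_N: "CARD('f) * card N = CARD('f) ^ (4 * k)"
proof -
  have "bij_betw (\<lambda>(a, b, c, h). (a, b, c, a + h)) (F \<times> F \<times> F \<times> H) N"
    by (rule bij_betw_byWitness[where f' = "\<lambda>(a, b, c, d). (a, b, c, a + d)"])
      (auto simp: H_def N_iff GF_ext_closed)
  from bij_betw_same_card[OF this]
  have "CARD('f) * card N = (CARD('f) ^ k) ^ 3 * (CARD('f) * card H)"
    by (simp add: card_cartesian_product card_GF_ext[OF k_pos] power3_eq_cube)
  then show ?thesis by (simp add: card_F_eq flip: power_mult power_add)
qed

text \<open>Test matrices with few nonzero entries force \<open>b = c = 0\<close>, then
  \<open>a = d\<close>, and finally that \<open>a\<close> is a scalar.\<close>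

lemma radical_N: "cone.radical N = range (\<lambda>t. scale4 t (1, 0, 0, 1))"
proof (intro equalityI subsetI)
  fix x assume "x \<in> cone.radical N"
  then have xN: "x \<in> N" and perp: "\<And>w. w \<in> N \<Longrightarrow> cone_form x w = 0"
    by (auto simp: cone.radical_def)
  obtain a b c d where x: "x = (a, b, c, d)" by (cases x)
  have in_F: "a \<in> F" "b \<in> F" "c \<in> F" "d \<in> F" using xN by (auto simp: x N_iff)
  have "b = 0"
    using perp[of "(0, 0, y, 0)" for y] by (intro T_nondegenerate in_F) (auto simp: x N_iff GF_ext_closed T.zero)
  moreover have "c = 0"
    using perp[of "(0, y, 0, 0)" for y] by (intro T_nondegenerate in_F) (auto simp: x N_iff GF_ext_closed T.zero)
  moreover have "a + d = 0"
    using perp[of "(y, 0, 0, y)" for y]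
    by (intro T_nondegenerate GF_ext_closed in_F) (auto simp: x N_iff GF_ext_closed T.zero distrib_right)
  \<comment> \<open>The entry \<open>y + to_ac (T y)\<close> lies in \<open>H\<close> for every
    \<open>y\<close> in \<open>F\<close>, and testing with it amounts to
    \<open>T ((a + to_ac (T a)) * y) = 0\<close>.\<close>
  moreover have "a + to_ac (T a) = 0"
  proof (rule T_nondegenerate)
    show "a + to_ac (T a) \<in> F" by (intro GF_ext_closed in_F)
    fix y assume y: "y \<in> F"
    have "(0, 0, 0, y + to_ac (T y)) \<in> N"
      using y by (simp add: N_iff GF_ext_closed T.zero T.add T_to_ac)
    from perp[OF this] have "T (a * (y + to_ac (T y))) = 0" by (simp add: x)
    then have "T (a * y) + T y * T a = 0"
      using T.scale[of "T y" a] by (simp add: distrib_left T.add mult.commute)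
    then show "T ((a + to_ac (T a)) * y) = 0"
      by (simp only: distrib_right T.add T.scale mult.commute[of "T a"])
  qed
  ultimately show "x \<in> range (\<lambda>t. scale4 t (1, 0, 0, 1))"
    by (intro range_eqI[of _ _ "T a"]) (simp add: x)
next
  fix x :: "'f quad" assume "x \<in> range (\<lambda>t. scale4 t (1, 0, 0, 1))"
  then obtain t where x: "x = (to_ac t, 0, 0, to_ac t)" by auto
  have "cone_form x w = 0" if "w \<in> N" for w
  proof -
    obtain a b c d where w: "w = (a, b, c, d)" by (cases w)
    have "cone_form x w = t * T (a + d)"
      using T.scale[of t "a + d"] by (simp add: x w distrib_left add.commute)
    with that show ?thesis by (simp add: w N_iff)
  qed
  then show "x \<in> cone.radical N"
    by (simp add: cone.radical_def x N_iff GF_ext_closed T.zero)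
qed

lemma card_radical_N: "card (cone.radical N) = CARD('f)"
  unfolding radical_N by (rule card_image) (auto intro: inj_onI)

lemma det4_in_F: "x \<in> N \<Longrightarrow> det4 x \<in> F"
  by (cases x) (simp add: N_iff GF_ext_closed)

section \<open>The quadratic form and its zeros\<close>

abbreviation Q :: "'f quad \<Rightarrow> 'f" where "Q x \<equiv> T (det4 x)"

lemma Q_add: "Q (x + y) = Q x + Q y + cone_form x y"
  by (cases x; cases y)
    (simp only: det4.simps cone_form.simps add_Pair distrib_left distrib_right T.add ac_simps)

lemma Q_scale: "Q (scale4 r x) = r * r * Q x"
proof (cases x)
  case (fields a b c d)
  have "det4 (scale4 r x) = to_ac (r * r) * det4 x" by (simp only: fields scale4.simps det4.simps to_ac_mult distrib_left ac_simps)
  then show ?thesis by (simp only: T.scale)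
qed

text \<open>Without a nonzero zero of \<open>det4\<close>, the function \<open>f\<close> below would
  sum to 1 over \<open>U\<close>, while its degree is small enough to force the sum 0.\<close>

lemma exists_singular:
  assumes U: "quad.subspace U" "U \<subseteq> N" "quad.dim U + 1 = 2 * k" and Q0: "\<And>x. x \<in> U \<Longrightarrow> Q x = 0"
  shows "\<exists>x\<in>U. x \<noteq> 0 \<and> det4 x = 0"
proof (rule ccontr)
  assume contra: "\<not> ?thesis"
  have nonsing: "det4 x \<noteq> 0" if "x \<in> U" "x \<noteq> 0" for x
  proof
    assume "det4 x = 0"
    with that have "\<exists>x\<in>U. x \<noteq> 0 \<and> det4 x = 0" by (intro bexI[of _ x] conjI)
    with contra show False by (rule notE)
  qed
  have finU: "finite U" using U(2) finite_N by (rule finite_subset)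
  \<comment> \<open>On \<open>U\<close>, \<open>f\<close> is the indicator function of \<open>det4 x = 0\<close>: for \<open>y = \<theta> * det4 x\<close> one has
    \<open>y * f x = GF_trace k y = to_ac (Q x) = 0\<close>.\<close>
  define f where "f = (\<lambda>x. \<Sum>i<k. (\<theta> * det4 x) ^ (CARD('f) ^ i - 1))"
  have \<theta>: "\<theta> \<noteq> 0"
  proof
    assume "\<theta> = 0"
    then have "to_ac (T 1) = 0"
      using T_trace[OF GF_ext_closed(2)] by (simp add: GF_trace_def zero_power)
    then show False by (simp add: T_1)
  qed
  have f0: "f 0 = 1"
  proof -
    \<comment> \<open>Only the term \<open>i = 0\<close> survives, through
      \<open>0 ^ 0 = 1\<close>.\<close>
    have "(0 :: 'f alg_closure) ^ (CARD('f) ^ i - 1) = (if i = 0 then 1 else 0)" for i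
    proof (cases "i = 0")
      case False
      then have "CARD('f) ^ i - 1 > 0"
        using one_less_power[OF CARD_field_gt_1[where 'f='f], of i] by simp
      then show ?thesis using False by (simp only: zero_power if_False)
    qed simp
    moreover have "\<theta> * det4 0 = 0" by (simp add: zero_prod_def)
    ultimately have "f 0 = (\<Sum>i<k. if i = 0 then 1 else 0)" by (simp only: f_def)
    then show ?thesis using k_pos by simp
  qed
  have f_eq_0: "f x = 0" if "x \<in> U" "x \<noteq> 0" for x
  proof -
    let ?y = "\<theta> * det4 x"
    have "?y * f x = (\<Sum>i<k. ?y ^ (CARD('f) ^ i))"
      unfolding f_def sum_distrib_left
    proof (rule sum.cong[OF refl])
      fix i
      have "?y ^ (CARD('f) ^ i - 1) * ?y = ?y ^ (CARD('f) ^ i)"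
        by (rule power_minus_mult) simp
      then show "?y * ?y ^ (CARD('f) ^ i - 1) = ?y ^ (CARD('f) ^ i)"
        by (simp only: mult.commute[of ?y])
    qed
    also have "\<dots> = to_ac (Q x)"
      using T_trace[OF det4_in_F, of x] U(2) that(1) by (simp add: GF_trace_def subsetD del: det4.simps)
    finally show ?thesis using Q0[OF that(1)] nonsing[OF that] \<theta> by simp
  qed
  have "(\<Sum>x\<in>U. f x) = 0"
  proof (rule quad.sum_poly_fun_eq_0[OF U(1) finU])
    let ?d = "(k - 1) * ((CARD('f) - 1) * 2)"
    show "quad.poly_fun ?d f"
      unfolding f_def
    proof (rule quad.poly_fun_sum)
      fix i assume "i \<in> {..<k}"
      then have "i * ((CARD('f) - 1) * 2) \<le> ?d" by (intro mult_right_mono) auto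
      then show "quad.poly_fun ?d (\<lambda>x. (\<theta> * det4 x) ^ (CARD('f) ^ i - 1))"
        by (rule quad.poly_fun_mono[OF poly_fun_det4])
    qed simp
    \<comment> \<open>The dimension exceeds twice the top index \<open>k - 1\<close> by one, which
      leaves a surplus of \<open>CARD('f) - 1\<close> over the degree bound.\<close>
    have "quad.dim U = 2 * (k - 1) + 1" using U(3) k_pos by linarith
    then have "quad.dim U * (CARD('f) - 1) = ?d + (CARD('f) - 1)"
      by (simp only: distrib_right mult_1)
    then show "?d < quad.dim U * (CARD('f) - 1)"
      using CARD_field_gt_1[where 'f='f] by linarith
  qed
  moreover have "(\<Sum>x\<in>U. f x) = (\<Sum>x\<in>{0}. f x)"
    using finU U(1) f_eq_0 by (intro sum.mono_neutral_right) (auto simp: quad.subspace_0)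
  ultimately show False using f0 by simp
qed

text \<open>The index is the point killed by the matrices: \<open>(1, 0)\<close> for \<open>None\<close> and \<open>(y, 1)\<close> for \<open>Some y\<close>.\<close>

definition ruling :: "'f alg_closure option \<Rightarrow> 'f quad set" where
  "ruling p = N \<inter> (case p of None \<Rightarrow> {(0, b, 0, d) | b d. True} | Some y \<Rightarrow> {(a, a * y, c, c * y) | a c. True})"

definition ruling_index :: "'f alg_closure option set" where
  "ruling_index = insert None (Some ` F)"

lemma card_ruling_index: "card ruling_index = CARD('f) ^ k + 1" "finite ruling_index"
  using finite_GF_ext[OF k_pos, where 'f='f]
  by (auto simp: ruling_index_def card_insert_if card_image card_GF_ext[OF k_pos])

lemma ruling_Some_iff: "(a, b, c, d) \<in> ruling (Some y) \<longleftrightarrow> (a, b, c, d) \<in> N \<and> b = a * y \<and> d = c * y"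
  by (auto simp: ruling_def)

lemma ruling_None_iff: "(a, b, c, d) \<in> ruling None \<longleftrightarrow> (a, b, c, d) \<in> N \<and> a = 0 \<and> c = 0"
  by (auto simp: ruling_def)

lemma ruling_subset: "ruling p \<subseteq> N" by (auto simp: ruling_def)

lemma subspace_ruling: "quad.subspace (ruling p)"
proof (rule quad.subspaceI)
  show "0 \<in> ruling p"
    using quad.subspace_0[OF subspace_N]
    by (cases p) (simp_all add: zero_prod_def ruling_Some_iff ruling_None_iff)
next
  fix x y assume xy: "x \<in> ruling p" "y \<in> ruling p"
  obtain a b c d a' b' c' d' where eq: "x = (a, b, c, d)" "y = (a', b', c', d')"
    by (cases x, cases y)
  have "x + y \<in> N"
    using xy by (intro quad.subspace_add[OF subspace_N]) (rule subsetD[OF ruling_subset], assumption)+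
  then show "x + y \<in> ruling p"
    using xy unfolding eq add_Pair
    by (cases p) (simp_all only: ruling_Some_iff ruling_None_iff distrib_right add_0_left simp_thms)
next
  fix r x assume x: "x \<in> ruling p"
  obtain a b c d where eq: "x = (a, b, c, d)" by (cases x)
  have "scale4 r x \<in> N"
    using x by (intro quad.subspace_scale[OF subspace_N]) (rule subsetD[OF ruling_subset], assumption)+
  then show "scale4 r x \<in> ruling p"
    using x unfolding eq scale4.simps
    by (cases p) (simp_all only: ruling_Some_iff ruling_None_iff mult.assoc mult_zero_right simp_thms)
qed

text \<open>For \<open>Some y\<close>, membership in \<open>N\<close> says that
  \<open>h = a + c * y\<close> lies in \<open>H\<close>, so \<open>c\<close> and \<open>h\<close>
  are free parameters; for \<open>None\<close> they are \<open>b\<close> and \<open>d\<close>, with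
  \<open>d\<close> in \<open>H\<close>.\<close>

lemma card_ruling:
  assumes "p \<in> ruling_index"
  shows "CARD('f) * card (ruling p) = CARD('f) ^ (2 * k)"
proof -
  have "\<exists>g. bij_betw g (F \<times> H) (ruling p)"
  proof (cases p)
    case None
    have "bij_betw (\<lambda>(b, h). (0, b, 0, h)) (F \<times> H) (ruling p)"
      unfolding None
      by (rule bij_betw_byWitness[where f' = "\<lambda>(a, b, c, d). (b, d)"])
        (auto simp: H_def N_iff ruling_None_iff ruling_def GF_ext_closed)
    then show ?thesis by blast
  next
    case (Some y)
    then have "y \<in> F" using assms by (auto simp: ruling_index_def)
    then have "bij_betw (\<lambda>(c, h). (h + c * y, (h + c * y) * y, c, c * y)) (F \<times> H) (ruling p)"
      unfolding Some
      by (intro bij_betw_byWitness[where f' = "\<lambda>(a, b, c, d). (c, a + d)"])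
        (auto simp: H_def N_iff ruling_Some_iff ruling_def add.assoc GF_ext_closed)
    then show ?thesis by blast
  qed
  then have "card (ruling p) = CARD('f) ^ k * card H"
    using bij_betw_same_card by (metis card_cartesian_product card_GF_ext[OF k_pos])
  then have "CARD('f) * card (ruling p) = CARD('f) ^ k * CARD('f) ^ k"
    using card_F_eq by simp
  then show ?thesis by (simp add: mult_2 power_add)
qed

text \<open>For \<open>Some t\<close> every term occurs twice and cancels in characteristic
  2.\<close>

lemma ruling_isotropic:
  assumes x: "x \<in> ruling p" and y: "y \<in> ruling p"
  shows "det4 x = 0" "cone_form x y = 0"
proof -
  obtain a b c d a' b' c' d' where eq: "x = (a, b, c, d)" "y = (a', b', c', d')"
    by (cases x, cases y)
  have "det4 x = 0 \<and> cone_form x y = 0"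
  proof (cases p)
    case None
    then have "a = 0" "c = 0" "a' = 0" "c' = 0" using x y by (simp_all add: eq ruling_None_iff)
    then show ?thesis by (simp add: eq T.zero)
  next
    case (Some t)
    then have *: "b = a * t" "d = c * t" "b' = a' * t" "d' = c' * t"
      using x y by (simp_all add: eq ruling_Some_iff)
    have "det4 x = a * (c * t) + a * (c * t)"
      unfolding eq det4.simps * by (simp only: mult.assoc mult.commute[of t c])
    moreover have "cone_form x y = T ((a * (c' * t) + c * (a' * t)) + (a * (c' * t) + c * (a' * t)))"
      unfolding eq cone_form.simps * by (simp only: mult.assoc mult.commute[of t] add.assoc)
    ultimately show ?thesis by (simp only: add_self T.zero)
  qed
  then show "det4 x = 0" "cone_form x y = 0" by simp_all
qed

text \<open>A matrix that kills two distinct points of the projective line is zero.\<close>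

lemma ruling_Int:
  assumes "p \<noteq> p'"
  shows "ruling p \<inter> ruling p' = {0}"
proof -
  have "x = 0" if "x \<in> ruling p" "x \<in> ruling p'" for x
    using that assms
    by (cases x; cases p; cases p') (auto simp: ruling_Some_iff ruling_None_iff zero_prod_def)
  then show ?thesis using quad.subspace_0[OF subspace_ruling] by auto
qed

text \<open>If the first column is nonzero, the second is a multiple of it, with the ratio read off
  from a nonzero entry; otherwise the index is \<open>None\<close>.\<close>

lemma singular_in_ruling:
  assumes "x \<in> N" "det4 x = 0"
  shows "\<exists>p\<in>ruling_index. x \<in> ruling p"
proof -
  obtain a b c d where x: "x = (a, b, c, d)" by (cases x)
  have F: "a \<in> F" "b \<in> F" "c \<in> F" "d \<in> F" using assms(1) by (auto simp: x N_iff)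
  have det: "a * d = b * c" using assms(2) by (simp add: x)
  consider "a \<noteq> 0" | "a = 0" "c \<noteq> 0" | "a = 0" "c = 0" by blast
  then show ?thesis
  proof cases
    case 1
    then have "x \<in> ruling (Some (b / a))"
      using assms(1) det by (simp add: x ruling_Some_iff field_simps)
    then show ?thesis using GF_ext_closed(6)[OF F(2,1)] by (auto simp: ruling_index_def)
  next
    case 2
    then have "x \<in> ruling (Some (d / c))"
      using assms(1) det by (simp add: x ruling_Some_iff)
    then show ?thesis using GF_ext_closed(6)[OF F(4,3)] by (auto simp: ruling_index_def)
  next
    case 3
    then have "x \<in> ruling None" using assms(1) by (simp add: x ruling_None_iff)
    then show ?thesis by (auto simp: ruling_index_def)
  qed
qed

text \<open>In characteristic 2 squaring is injective, hence surjective on a finite field.\<close>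

lemma exists_sqrt: "\<exists>t. t * t = (c :: 'f)"
proof -
  have "inj (\<lambda>t :: 'f. t * t)" by (rule injI) (simp add: square_eq_iff minus_eq_scalar)
  then have "surj (\<lambda>t :: 'f. t * t)" by (rule finite_UNIV_inj_surj[OF finite])
  then show ?thesis by (metis surjD)
qed

lemma cone_form_radical:
  assumes "x \<in> N"
  shows "cone_form x (scale4 t (1, 0, 0, 1)) = 0"
proof -
  have "scale4 t (1, 0, 0, 1) \<in> cone.radical N" unfolding radical_N by (rule rangeI)
  with assms have "cone_form (scale4 t (1, 0, 0, 1)) x = 0" unfolding cone.radical_def by simp
  then show ?thesis using cone.form_commute[of x] by simp
qed

lemma Q_add_radical:
  assumes "x \<in> N"
  shows "Q (x + scale4 t (1, 0, 0, 1)) = Q x + t * t"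
  unfolding Q_add cone_form_radical[OF assms] Q_scale by (simp add: T_1)

text \<open>Radical elements shift \<open>Q\<close> by squares, and every scalar is a square.
  Together with \<open>Q_eq_0_unique_mod_radical\<close>, each coset of the radical in
  \<open>N\<close> contains exactly one zero of \<open>Q\<close>.\<close>

lemma exists_Q_eq_0_mod_radical:
  assumes "x \<in> N"
  shows "\<exists>r\<in>cone.radical N. Q (x + r) = 0"
proof -
  obtain t where "t * t = Q x" using exists_sqrt[of "Q x"] by (rule exE)
  then have "Q (x + scale4 t (1, 0, 0, 1)) = 0" using Q_add_radical[OF assms] by simp
  then show ?thesis unfolding radical_N by (rule bexI[OF _ rangeI])
qed

lemma Q_eq_0_unique_mod_radical:
  assumes "x \<in> N" "y \<in> N" "Q x = 0" "Q y = 0" "x - y \<in> cone.radical N"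
  shows "x = y"
proof -
  obtain t where t: "x - y = scale4 t (1, 0, 0, 1)"
    using assms(5) unfolding radical_N by (rule rangeE)
  then have x: "x = y + scale4 t (1, 0, 0, 1)" by (metis add.commute diff_add_cancel)
  have "t * t = 0"
    using Q_add_radical[OF assms(2), of t] unfolding x[symmetric] assms(3,4) by simp
  then have "x - y = 0" using t by (simp add: zero_prod_def)
  then show ?thesis by (simp only: right_minus_eq)
qed

end

section \<open>The partial spread\<close>

theorem theorem6p2:
  fixes scale :: "'f::{field,finite} \<Rightarrow> 'v::ab_group_add \<Rightarrow> 'v"
    and form :: "'v \<Rightarrow> 'v \<Rightarrow> 'f"
    and n q k :: nat
  assumes "even q" and "k \<ge> 2"
    and "2 * n = 4 * k - 2"
    and "Sp_space scale form n q"
  shows "\<exists>S. Sp_space.maximal_symplectic_partial_spread scale form n S \<and> card S = q ^ k + 1"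
proof -
  interpret Sp: Sp_space scale form n q by fact
  interpret V: vector_space_over_finite scale by unfold_locales
  interpret alternating_space scale form
    by (intro alternating_space.intro alternating_space_axioms.intro Sp.vector_space_axioms
      Sp.form_linear_left Sp.form_linear_right Sp.form_alternating)
  have q: "q = CARD('f)" by (simp add: Sp.card_field)
  have q_gt_1: "q > 1" unfolding q by (rule CARD_field_gt_1)
  have n: "n + 1 = 2 * k" "n > 0" using assms(2,3) by auto
  \<comment> \<open>A finite spanning set over a finite field makes the space finite, so dimensions
    can be compared through cardinalities.\<close>
  obtain A where A: "finite A" "Sp.span A = UNIV" using Sp.finite_dim by (elim exE conjE)
  obtain B where B: "B \<subseteq> A" "Sp.independent B" "A \<subseteq> Sp.span B"
    by (rule Sp.maximal_independent_subset)
  have "finite B" using B(1) A(1) by (rule finite_subset)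
  moreover have "Sp.span B = UNIV"
    using Sp.span_minimal[OF B(3) Sp.subspace_span] unfolding A(2) by (rule top.extremum_uniqueI)
  ultimately have finV: "finite (UNIV :: 'v set)"
    using V.card_span[of B] B(2) card_ge_0_finite[of "UNIV :: 'v set"] by simp
  have card_subspace: "card U = q ^ Sp.dim U" if "Sp.subspace U" for U
    using V.card_subspace[OF that] finV unfolding q by (simp add: finite_subset[OF subset_UNIV])
  have cardV: "card (UNIV :: 'v set) = q ^ (2 * n)"
    using card_subspace[OF Sp.subspace_UNIV] by (simp add: Sp.dim_space)

  obtain T :: "'f alg_closure \<Rightarrow> 'f" and \<theta> where T: "Vector_Spaces.linear (\<lambda>c x. to_ac c * x) (*) T"
    "T 1 = 1" "\<forall>y\<in>GF_ext k. to_ac (T y) = GF_trace k (\<theta> * y)"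
    using exists_GF_functional[of k, where 'f='f] assms(2) by auto
  interpret trace_cone k T \<theta>
    by (rule trace_cone.intro) (use T assms(1,2) q in simp_all)
  interpret pair: alternating_space_pair scale4 cone_form scale form ..
  have "radical UNIV = {0}"
    using Sp.form_nondegenerate left.zero by (auto simp: radical_def)
  \<comment> \<open>This count, \<open>q ^ (4 * k - 1)\<close> on both sides, lets \<open>N\<close>
    modulo its radical match the given space.\<close>
  moreover have "card N = card (cone.radical N) * card (UNIV :: 'v set)"
  proof -
    have "4 * k = 2 + 2 * n" using n by linarith
    then have "q * card N = q * (q * q ^ (2 * n))"
      using card_N unfolding q[symmetric] by (simp add: power_add power2_eq_square)
    then show ?thesis using q_gt_1 unfolding card_radical_N cardV q[symmetric] by simp
  qed
  ultimately obtain \<phi> where \<phi>: "Vector_Spaces.linear scale4 scale \<phi>" "\<phi> ` N = UNIV"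
    "\<forall>v\<in>N. \<forall>w\<in>N. form (\<phi> v) (\<phi> w) = cone_form v w"
    using pair.exists_isometry_mod_radical[OF subspace_N finite_N Sp.subspace_UNIV finV]
    by auto
  interpret \<phi>: Vector_Spaces.linear scale4 scale \<phi> by (rule \<phi>(1))

  have \<phi>_radical: "r \<in> cone.radical N \<longleftrightarrow> \<phi> r = 0" if "r \<in> N" for r
  proof -
    have "r \<in> cone.radical N \<longleftrightarrow> (\<forall>w\<in>N. form (\<phi> r) (\<phi> w) = 0)"
      using that \<phi>(3) by (simp add: cone.radical_def)
    also have "\<dots> \<longleftrightarrow> (\<forall>w\<in>\<phi> ` N. form (\<phi> r) w = 0)" by simp
    also have "\<dots> \<longleftrightarrow> \<phi> r = 0" unfolding \<phi>(2) using Sp.form_nondegenerate by (auto simp: left.zero)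
    finally show ?thesis .
  qed
  \<comment> \<open>The kernel of \<open>\<phi>\<close> on \<open>N\<close> is the radical, but a
    coset of the radical contains only one zero of \<open>Q\<close>.\<close>
  have \<phi>_inj: "x = y" if "x \<in> N" "y \<in> N" "Q x = 0" "Q y = 0" "\<phi> x = \<phi> y" for x y
  proof (rule Q_eq_0_unique_mod_radical[OF that(1-4)])
    have "x - y \<in> N" using that(1,2) by (rule quad.subspace_diff[OF subspace_N])
    then show "x - y \<in> cone.radical N" using that(5) by (simp add: \<phi>_radical \<phi>.diff)
  qed
  have ruling_Q: "x \<in> N" "Q x = 0" if "x \<in> ruling p" for x p
    using that ruling_subset[of p] ruling_isotropic(1)[OF that that] by (auto simp: T.zero)

  define S where "S = (\<lambda>p. \<phi> ` ruling p) ` ruling_index"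
  have card_image: "card (\<phi> ` ruling p) = q ^ n" if "p \<in> ruling_index" for p
  proof -
    have "inj_on \<phi> (ruling p)" by (rule inj_onI) (rule \<phi>_inj; (rule ruling_Q | assumption); assumption)
    then have "card (\<phi> ` ruling p) = card (ruling p)" by (rule card_image)
    moreover have "q * card (ruling p) = q * q ^ n"
      using card_ruling[OF that] unfolding q[symmetric] n(1)[symmetric] by simp
    ultimately show ?thesis using q_gt_1 by simp
  qed
  have image_Int: "\<phi> ` ruling p \<inter> \<phi> ` ruling p' = {0}" if "p \<noteq> p'" for p p'
  proof -
    have "v = 0" if v: "v \<in> \<phi> ` ruling p" "v \<in> \<phi> ` ruling p'" for v
    proof -
      obtain x where x: "v = \<phi> x" "x \<in> ruling p" using v(1) by (rule imageE)
      obtain y where y: "v = \<phi> y" "y \<in> ruling p'" using v(2) by (rule imageE)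
      have "x = y" by (rule \<phi>_inj) (use x y ruling_Q in simp_all)
      then have "x \<in> ruling p \<inter> ruling p'" using x y by simp
      then show ?thesis unfolding ruling_Int[OF \<open>p \<noteq> p'\<close>] by (simp add: x(1) \<phi>.zero)
    qed
    moreover have "0 \<in> \<phi> ` ruling p" for p
      using \<phi>.zero quad.subspace_0[OF subspace_ruling] by (metis imageI)
    ultimately show ?thesis by auto
  qed
  \<comment> \<open>Equal images for distinct indices would be zero, against their
    \<open>q ^ n > 1\<close> elements.\<close>
  have image_inj: "p = p'" if "p \<in> ruling_index" "\<phi> ` ruling p = \<phi> ` ruling p'" for p p'
  proof (rule ccontr)
    assume "p \<noteq> p'"
    then have "\<phi> ` ruling p = {0}" using image_Int[of p p'] that(2) by simp
    then show False using card_image[OF that(1)] one_less_power[OF q_gt_1 n(2)] by simp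
  qed
  have dim_iff: "Sp.dim U = n \<longleftrightarrow> card U = q ^ n" if "Sp.subspace U" for U
    using card_subspace[OF that] q_gt_1 by simp
  have subspace_image: "Sp.subspace (\<phi> ` ruling p)" for p
    by (rule \<phi>.subspace_image[OF subspace_ruling])
  have isotropic_image: "Sp.totally_isotropic (\<phi> ` ruling p)" for p
    unfolding Sp.totally_isotropic_def
  proof (intro conjI ballI)
    fix u w assume uw: "u \<in> \<phi> ` ruling p" "w \<in> \<phi> ` ruling p"
    obtain x where "u = \<phi> x" "x \<in> ruling p" using uw(1) by (rule imageE)
    moreover obtain y where "w = \<phi> y" "y \<in> ruling p" using uw(2) by (rule imageE)
    ultimately show "form u w = 0" using \<phi>(3) ruling_Q(1) ruling_isotropic(2) by simp
  qed (rule subspace_image)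
  have spread: "Sp.symplectic_partial_spread S"
    unfolding Sp.symplectic_partial_spread_def
  proof (intro conjI ballI pairwiseI)
    fix U assume "U \<in> S"
    then obtain p where p: "p \<in> ruling_index" "U = \<phi> ` ruling p" by (auto simp: S_def)
    show "Sp.totally_isotropic U" unfolding p(2) by (rule isotropic_image)
    show "Sp.dim U = n" unfolding p(2) dim_iff[OF subspace_image] by (rule card_image[OF p(1)])
  next
    fix U W assume UW: "U \<in> S" "W \<in> S" "U \<noteq> W"
    obtain p where p: "U = \<phi> ` ruling p" using UW(1) unfolding S_def by (rule imageE)
    obtain p' where p': "W = \<phi> ` ruling p'" using UW(2) unfolding S_def by (rule imageE)
    have "p \<noteq> p'" using UW(3) unfolding p p' by (rule contrapos_nn) simp
    then show "U \<inter> W = {0}" unfolding p p' by (rule image_Int)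
  qed

  \<comment> \<open>Here \<open>W\<close> stands for a further member of a larger partial
    spread.\<close>
  have False if W: "Sp.totally_isotropic W" "Sp.dim W = n" "\<And>U. U \<in> S \<Longrightarrow> U \<inter> W = {0}" for W
  proof -
    have subW: "Sp.subspace W" and formW: "\<And>u w. u \<in> W \<Longrightarrow> w \<in> W \<Longrightarrow> form u w = 0"
      using W(1) by (auto simp: Sp.totally_isotropic_def)
    \<comment> \<open>The lift of \<open>W\<close>: each element of \<open>W\<close> has exactly one
      preimage in \<open>N\<close> at which \<open>Q\<close> vanishes.\<close>
    define U where "U = {x \<in> N. \<phi> x \<in> W \<and> Q x = 0}"
    have subU: "quad.subspace U"
    proof (rule quad.subspaceI)
      show "0 \<in> U"
        using quad.subspace_0[OF subspace_N] Sp.subspace_0[OF subW]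
        by (simp add: U_def \<phi>.zero) (simp add: zero_prod_def T.zero)
    next
      fix x y assume xy: "x \<in> U" "y \<in> U"
      then have "x \<in> N" "y \<in> N" "\<phi> x \<in> W" "\<phi> y \<in> W" "Q x = 0" "Q y = 0" by (simp_all add: U_def)
      \<comment> \<open>Isotropy of \<open>W\<close> pulls back to \<open>U\<close>, so
        \<open>Q\<close> is additive there.\<close>
      moreover from this have "cone_form x y = 0" using \<phi>(3) formW by metis
      ultimately show "x + y \<in> U"
        unfolding U_def mem_Collect_eq Q_add \<phi>.add
        by (simp add: quad.subspace_add[OF subspace_N] Sp.subspace_add[OF subW])
    next
      fix r x assume "x \<in> U"
      then have "x \<in> N" "\<phi> x \<in> W" "Q x = 0" by (simp_all add: U_def)
      then show "scale4 r x \<in> U"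
        unfolding U_def mem_Collect_eq Q_scale \<phi>.scale
        by (simp add: quad.subspace_scale[OF subspace_N] Sp.subspace_scale[OF subW])
    qed
    have "bij_betw \<phi> U W"
    proof (rule bij_betw_imageI)
      show "inj_on \<phi> U" by (rule inj_onI) (rule \<phi>_inj; simp add: U_def)
      show "\<phi> ` U = W"
      proof (intro equalityI subsetI)
        fix w assume w: "w \<in> W"
        have "w \<in> \<phi> ` N" by (simp add: \<phi>(2))
        then obtain x where x: "w = \<phi> x" "x \<in> N" by (rule imageE)
        \<comment> \<open>A radical element corrects the preimage to a zero of \<open>Q\<close>
          without changing its image.\<close>
        obtain r where r: "r \<in> cone.radical N" "Q (x + r) = 0"
          using exists_Q_eq_0_mod_radical[OF x(2)] by (rule bexE)
        then have "r \<in> N" by (simp add: cone.radical_def)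
        then have \<phi>_eq: "w = \<phi> (x + r)" using r(1) by (simp add: \<phi>_radical \<phi>.add x(1))
        have "x + r \<in> N" using x(2) \<open>r \<in> N\<close> by (rule quad.subspace_add[OF subspace_N])
        then have "x + r \<in> U" using r(2) w \<phi>_eq by (simp add: U_def)
        with \<phi>_eq show "w \<in> \<phi> ` U" by (rule image_eqI)
      qed (auto simp: U_def)
    qed
    then have "card U = q ^ n"
      using bij_betw_same_card[of \<phi> U W] dim_iff[OF subW] W(2) by simp
    moreover have "U \<subseteq> N" by (auto simp: U_def)
    moreover from this have "finite U" using finite_N by (rule finite_subset)
    ultimately have "quad.dim U = n"
      using quad.card_subspace[OF subU] q_gt_1 unfolding q[symmetric] by simp
    then have "quad.dim U + 1 = 2 * k" using n(1) by simp
    then have "\<exists>x\<in>U. x \<noteq> 0 \<and> det4 x = 0"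
      by (rule exists_singular[OF subU \<open>U \<subseteq> N\<close>]) (simp add: U_def)
    then obtain x where x: "x \<in> U" "x \<noteq> 0" "det4 x = 0" by (elim bexE conjE)
    then have "x \<in> N" "\<phi> x \<in> W" by (simp_all add: U_def)
    obtain p where p: "p \<in> ruling_index" "x \<in> ruling p"
      using singular_in_ruling[OF \<open>x \<in> N\<close> x(3)] by (rule bexE)
    \<comment> \<open>The singular vector lies on the ruling, so its image is common to
      \<open>W\<close> and a member of \<open>S\<close>.\<close>
    have "\<phi> x \<in> \<phi> ` ruling p \<inter> W" using p(2) \<open>\<phi> x \<in> W\<close> by (intro IntI imageI)
    also have "\<phi> ` ruling p \<inter> W = {0}" by (rule W(3)) (simp add: S_def p(1))
    finally have "\<phi> x = \<phi> 0" by (simp add: \<phi>.zero)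
    \<comment> \<open>Both \<open>x\<close> and 0 lie in \<open>ruling p\<close>, on which
      \<open>\<phi>\<close> is injective.\<close>
    then have "x = 0"
      using ruling_Q[OF p(2)] ruling_Q[OF quad.subspace_0[OF subspace_ruling]] by (intro \<phi>_inj)
    with x(2) show False by simp
  qed
  note no_extension = this
  have "\<not> (\<exists>S'. Sp.symplectic_partial_spread S' \<and> S \<subset> S')"
  proof (rule notI, elim exE conjE)
    fix S' assume S': "Sp.symplectic_partial_spread S'" "S \<subset> S'"
    obtain W where W: "W \<in> S' - S" using psubset_imp_ex_mem[OF S'(2)] by (rule exE)
    show False
    proof (rule no_extension)
      show "Sp.totally_isotropic W" "Sp.dim W = n"
        using S'(1) W by (simp_all add: Sp.symplectic_partial_spread_def)
      fix U assume "U \<in> S"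
      then have "U \<in> S'" "U \<noteq> W" using S'(2) W by auto
      then show "U \<inter> W = {0}"
        using S'(1) W by (simp add: Sp.symplectic_partial_spread_def pairwise_def)
    qed
  qed
  moreover have "card S = q ^ k + 1"
    unfolding S_def using card_ruling_index(1) image_inj unfolding q[symmetric]
    by (subst Finite_Set.card_image) (auto intro: inj_onI)
  ultimately show ?thesis
    using spread by (intro exI[of _ S]) (simp add: Sp.maximal_symplectic_partial_spread_def)
qed

end
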